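(* Let $n\in\{2,3\}$ and let $\Omega\subset\mathbb{R}^n$ be a bounded domain. If $\Omega$ supports the improved Poincaré inequality with the constant $P_\Omega$, then it also supports the Friedrichs-Velte inequality, and its Friedrichs-Velte constant satisfies $$\Gamma_\Omega\le 4P_\Omega .$$
   Context: Functions are real-valued, $\|\cdot\|$ is the $L_2(\Omega)$ norm (of scalar or vector functions), $f_\Omega=\frac1{|\Omega|}\int_\Omega f$, and $d_\Omega(x)=\mathrm{dist}(x,\partial\Omega)$. Derivatives are in the distributional sense. $\Omega$ supports the improved Poincaré inequality if there is a finite constant $P>0$ such that $\|u-u_\Omega\|^2\le P\|d_\Omega\nabla u\|^2$ for every $u\in L_{1,loc}(\Omega)$ with $d_\Omega\nabla u\in L_2(\Omega)^n$ (it being part of the inequality that $u$ is integrable, so that $u_\Omega$ is meaningful); $P_\Omega$ is the least such constant. Conjugate harmonic functions: for $n=2$, scalar functions $u,v$ with $\nabla u=\nabla^{\bot}v$, where $\nabla^\bot=(\partial_2,-\partial_1)$; for $n=3$, a scalar function $u$ and a vector field $v$ with $\mathrm{rot}\,v=\nabla u$ and $\mathrm{div}\,v=0$ ($\mathrm{rot}$ is the curl). $\Omega$ supports the Friedrichs-Velte inequality if there is a finite constant $\Gamma>0$ such that $\|u\|^2\le\Gamma\|v\|^2$ for every pair of square integrable conjugate harmonic functions $u,v$ on $\Omega$ with $u_\Omega=0$; $\Gamma_\Omega$ is the least such constant. *)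

theory Defs
  imports "HOL-Analysis.Analysis"
begin

definition partial_deriv :: "'n \<Rightarrow> (real^'n \<Rightarrow> real) \<Rightarrow> real^'n \<Rightarrow> real" where
  "partial_deriv i f x = frechet_derivative f (at x) (axis i 1)"

primrec times_cont_diff :: "nat \<Rightarrow> (real^'n \<Rightarrow> real) \<Rightarrow> bool" where
  "times_cont_diff 0 f \<longleftrightarrow> continuous_on UNIV f"
| "times_cont_diff (Suc k) f \<longleftrightarrow>
     f differentiable_on UNIV \<and> (\<forall>i. times_cont_diff k (partial_deriv i f))"

definition test_functions :: "(real^'n) set \<Rightarrow> (real^'n \<Rightarrow> real) set" where
  "test_functions \<Omega> = {\<phi>. (\<forall>k. times_cont_diff k \<phi>) \<and>
     compact (closure {x. \<phi> x \<noteq> 0}) \<and> closure {x. \<phi> x \<noteq> 0} \<subseteq> \<Omega>}"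

definition locally_integrable_on :: "(real^'n \<Rightarrow> real) \<Rightarrow> (real^'n) set \<Rightarrow> bool" where
  "locally_integrable_on u \<Omega> \<longleftrightarrow>
     (\<forall>K. compact K \<and> K \<subseteq> \<Omega> \<longrightarrow> u absolutely_integrable_on K)"

text \<open>The distributional partial derivative of a locally integrable function, as a functional on test
  functions.\<close>

definition distr_partial ::
  "(real^'n) set \<Rightarrow> 'n \<Rightarrow> (real^'n \<Rightarrow> real) \<Rightarrow> (real^'n \<Rightarrow> real) \<Rightarrow> real" where
  "distr_partial \<Omega> i u \<phi> = - (LINT x:\<Omega>|lebesgue. u x * partial_deriv i \<phi> x)"

definition distr_grad ::
  "(real^'n) set \<Rightarrow> (real^'n \<Rightarrow> real) \<Rightarrow> (real^'n \<Rightarrow> real) \<Rightarrow> real^'n" where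
  "distr_grad \<Omega> u \<phi> = (\<chi> i. distr_partial \<Omega> i u \<phi>)"

definition distr_div ::
  "(real^'n) set \<Rightarrow> (real^'n \<Rightarrow> real^'n) \<Rightarrow> (real^'n \<Rightarrow> real) \<Rightarrow> real" where
  "distr_div \<Omega> v \<phi> = (\<Sum>i\<in>UNIV. distr_partial \<Omega> i (\<lambda>x. v x $ i) \<phi>)"

definition distr_perp_grad ::
  "(real^2) set \<Rightarrow> (real^2 \<Rightarrow> real) \<Rightarrow> (real^2 \<Rightarrow> real) \<Rightarrow> real^2" where
  "distr_perp_grad \<Omega> v \<phi> = vector [distr_partial \<Omega> 2 v \<phi>, - distr_partial \<Omega> 1 v \<phi>]"

definition distr_rot ::
  "(real^3) set \<Rightarrow> (real^3 \<Rightarrow> real^3) \<Rightarrow> (real^3 \<Rightarrow> real) \<Rightarrow> real^3" where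
  "distr_rot \<Omega> v \<phi> = vector
     [distr_partial \<Omega> 2 (\<lambda>x. v x $ 3) \<phi> - distr_partial \<Omega> 3 (\<lambda>x. v x $ 2) \<phi>,
      distr_partial \<Omega> 3 (\<lambda>x. v x $ 1) \<phi> - distr_partial \<Omega> 1 (\<lambda>x. v x $ 3) \<phi>,
      distr_partial \<Omega> 1 (\<lambda>x. v x $ 2) \<phi> - distr_partial \<Omega> 2 (\<lambda>x. v x $ 1) \<phi>]"

text \<open>The distributional gradient of \<open>u\<close> is the locally integrable vector field \<open>g\<close>.\<close>

definition has_distr_grad ::
  "(real^'n) set \<Rightarrow> (real^'n \<Rightarrow> real) \<Rightarrow> (real^'n \<Rightarrow> real^'n) \<Rightarrow> bool" where
  "has_distr_grad \<Omega> u g \<longleftrightarrow>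
     locally_integrable_on u \<Omega> \<and> (\<forall>i. locally_integrable_on (\<lambda>x. g x $ i) \<Omega>) \<and>
     (\<forall>\<phi>\<in>test_functions \<Omega>. distr_grad \<Omega> u \<phi> = (\<chi> i. LINT x:\<Omega>|lebesgue. g x $ i * \<phi> x))"

text \<open>The squared \<open>L\<^sub>2\<close> norm takes values in \<^typ>\<open>ennreal\<close>, so that it is infinite
  (rather than \<open>0\<close>) for functions which are not square integrable.\<close>

definition L2_norm_sq :: "(real^'n) set \<Rightarrow> (real^'n \<Rightarrow> 'b::real_normed_vector) \<Rightarrow> ennreal" where
  "L2_norm_sq \<Omega> f = (\<integral>\<^sup>+x\<in>\<Omega>. ennreal ((norm (f x))\<^sup>2) \<partial>lebesgue)"

definition square_integrable_on ::
  "(real^'n \<Rightarrow> 'b::real_normed_vector) \<Rightarrow> (real^'n) set \<Rightarrow> bool" where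
  "square_integrable_on f \<Omega> \<longleftrightarrow>
     f \<in> borel_measurable (lebesgue_on \<Omega>) \<and> L2_norm_sq \<Omega> f < \<infinity>"

definition mean_value :: "(real^'n) set \<Rightarrow> (real^'n \<Rightarrow> real) \<Rightarrow> real" where
  "mean_value \<Omega> f = (LINT x:\<Omega>|lebesgue. f x) / measure lebesgue \<Omega>"

definition improved_Poincare_with :: "(real^'n) set \<Rightarrow> real \<Rightarrow> bool" where
  "improved_Poincare_with \<Omega> P \<longleftrightarrow>
     (\<forall>u g. has_distr_grad \<Omega> u g \<and>
            square_integrable_on (\<lambda>x. infdist x (frontier \<Omega>) *\<^sub>R g x) \<Omega> \<longrightarrow>
        u absolutely_integrable_on \<Omega> \<and>
        L2_norm_sq \<Omega> (\<lambda>x. u x - mean_value \<Omega> u)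
          \<le> ennreal P * L2_norm_sq \<Omega> (\<lambda>x. infdist x (frontier \<Omega>) *\<^sub>R g x))"

definition supports_improved_Poincare :: "(real^'n) set \<Rightarrow> bool" where
  "supports_improved_Poincare \<Omega> \<longleftrightarrow> (\<exists>P>0. improved_Poincare_with \<Omega> P)"

text \<open>The least constant is the infimum of the admissible ones: the inequality is preserved
  under limits of the constant. It is meaningful only if some constant is admissible.\<close>

definition improved_Poincare_const :: "(real^'n) set \<Rightarrow> real" where
  "improved_Poincare_const \<Omega> = Inf {P. 0 < P \<and> improved_Poincare_with \<Omega> P}"

definition conjugate_harmonic2 ::
  "(real^2) set \<Rightarrow> (real^2 \<Rightarrow> real) \<Rightarrow> (real^2 \<Rightarrow> real) \<Rightarrow> bool" where
  "conjugate_harmonic2 \<Omega> u v \<longleftrightarrow>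
     locally_integrable_on u \<Omega> \<and> locally_integrable_on v \<Omega> \<and>
     (\<forall>\<phi>\<in>test_functions \<Omega>. distr_grad \<Omega> u \<phi> = distr_perp_grad \<Omega> v \<phi>)"

definition conjugate_harmonic3 ::
  "(real^3) set \<Rightarrow> (real^3 \<Rightarrow> real) \<Rightarrow> (real^3 \<Rightarrow> real^3) \<Rightarrow> bool" where
  "conjugate_harmonic3 \<Omega> u v \<longleftrightarrow>
     locally_integrable_on u \<Omega> \<and> (\<forall>i. locally_integrable_on (\<lambda>x. v x $ i) \<Omega>) \<and>
     (\<forall>\<phi>\<in>test_functions \<Omega>. distr_rot \<Omega> v \<phi> = distr_grad \<Omega> u \<phi> \<and> distr_div \<Omega> v \<phi> = 0)"

text \<open>The Friedrichs-Velte notions take the conjugacy relation \<open>CH\<close> as a parameter: it is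
  \<^const>\<open>conjugate_harmonic2\<close> in the plane and \<^const>\<open>conjugate_harmonic3\<close> in space.\<close>

definition Friedrichs_Velte_with ::
  "((real^'n) set \<Rightarrow> (real^'n \<Rightarrow> real) \<Rightarrow> (real^'n \<Rightarrow> 'b::real_normed_vector) \<Rightarrow> bool)
     \<Rightarrow> (real^'n) set \<Rightarrow> real \<Rightarrow> bool" where
  "Friedrichs_Velte_with CH \<Omega> \<Gamma> \<longleftrightarrow>
     (\<forall>u v. square_integrable_on u \<Omega> \<and> square_integrable_on v \<Omega> \<and> CH \<Omega> u v \<and>
            mean_value \<Omega> u = 0 \<longrightarrow>
        L2_norm_sq \<Omega> u \<le> ennreal \<Gamma> * L2_norm_sq \<Omega> v)"

definition supports_Friedrichs_Velte ::
  "((real^'n) set \<Rightarrow> (real^'n \<Rightarrow> real) \<Rightarrow> (real^'n \<Rightarrow> 'b::real_normed_vector) \<Rightarrow> bool)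
     \<Rightarrow> (real^'n) set \<Rightarrow> bool" where
  "supports_Friedrichs_Velte CH \<Omega> \<longleftrightarrow> (\<exists>\<Gamma>>0. Friedrichs_Velte_with CH \<Omega> \<Gamma>)"

definition Friedrichs_Velte_const ::
  "((real^'n) set \<Rightarrow> (real^'n \<Rightarrow> real) \<Rightarrow> (real^'n \<Rightarrow> 'b::real_normed_vector) \<Rightarrow> bool)
     \<Rightarrow> (real^'n) set \<Rightarrow> real" where
  "Friedrichs_Velte_const CH \<Omega> = Inf {\<Gamma>. 0 < \<Gamma> \<and> Friedrichs_Velte_with CH \<Omega> \<Gamma>}"

end

theory Submission
  imports Defs "HOL-Computational_Algebra.Polynomial"
begin

text \<open>Let \<open>u, v\<close> be square integrable conjugate harmonic functions with \<open>u\<^sub>\<Omega> = 0\<close>. By the improved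
  Poincare inequality it suffices to prove the weighted estimate
  \<open>\<parallel>d\<^sub>\<Omega> \<nabla>u\<parallel>\<^sup>2 \<le> 4 \<parallel>v\<parallel>\<^sup>2\<close>. This is a Caccioppoli estimate: \<open>\<nabla>u = rot v\<close>, so
  for a cutoff function \<open>\<phi>\<close> with \<open>\<bar>\<nabla>\<phi>\<bar> \<le> 1\<close> integration by parts and \<open>rot \<nabla>u = 0\<close> give
  \<open>\<integral> \<phi>\<^sup>2 \<bar>\<nabla>u\<bar>\<^sup>2 = - 2 \<integral> \<phi> (\<nabla>\<phi> \<times> \<nabla>u) \<bullet> v \<le> 2 \<parallel>\<phi> \<nabla>u\<parallel> \<parallel>v\<parallel>\<close>; the functions \<open>\<phi>\<close> approximate
  \<open>d\<^sub>\<Omega>\<close>. Distributional derivatives are handled by mollification with radial kernels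
  \<open>\<rho>\<^sub>t\<close>: as \<open>u\<close> is harmonic, \<open>u * \<rho>\<^sub>t\<close> does not depend on \<open>t\<close>, which yields a smooth gradient on all of
  \<open>\<Omega>\<close>, while \<open>\<parallel>v * \<rho>\<^sub>t\<parallel> \<le> \<parallel>v\<parallel>\<close>.\<close>

subsection \<open>A smooth bump function\<close>

text \<open>The obstacle is that the improved Poincare inequality has to be applied to u itself, on
  all of \<Omega> and with a genuine function as gradient, whereas a mollification of fixed radius t
  is faithful only at points deeper than t. Independence of the radius permits a radius that depends
  on the point. The cutoff estimate, in contrast, works at one fixed radius with functions that are
  smooth on the whole space, and their conjugacy is demanded only where the cutoff lives. The
  constant 4 is that of X^2 \<le> 2 X Y, which gives X^2 \<le> 4 Y^2. To keep it sharp, no step may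
  lose a factor: the cutoff must have gradient at most 1 after smoothing, and smoothing v must not
  increase its norm. Both dimensions are covered at once because two properties of the coefficients
  of the conjugacy relation suffice. Antisymmetry makes u harmonic and removes the second
  derivatives of u from the integration by parts; norm at most 1 of the trilinear form preserves the
  constant.\<close>

definition bump :: "real poly \<Rightarrow> real \<Rightarrow> real" where
  "bump p r = (if r > 0 then poly p (1 / r) * exp (- (1 / r)) else 0)"

lemma poly_times_exp_tendsto_0: "((\<lambda>x::real. poly p x * exp (- x)) \<longlongrightarrow> 0) at_top"
proof -
  have *: "poly p x * exp (- x) = (\<Sum>i\<le>degree p. coeff p i * (x ^ i / exp x))" for x :: real
    by (simp add: poly_altdef sum_distrib_right exp_minus inverse_eq_divide flip: times_divide_eq_right)
       (simp add: sum_divide_distrib)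
  show ?thesis
    unfolding * by (intro tendsto_null_sum tendsto_mult_right_zero tendsto_power_div_exp_0)
qed

lemma bump_tendsto_0: "(bump p \<longlongrightarrow> 0) (at 0)"
proof -
  have "((\<lambda>r::real. poly p (inverse r) * exp (- inverse r)) \<longlongrightarrow> 0) (at_right 0)"
    by (rule filterlim_compose[OF poly_times_exp_tendsto_0 filterlim_inverse_at_top_right])
  then have "(bump p \<longlongrightarrow> 0) (at_right 0)"
    by (rule Lim_transform_eventually) (auto simp: eventually_at_filter bump_def inverse_eq_divide)
  moreover have "(bump p \<longlongrightarrow> 0) (at_left 0)"
    by (rule Lim_transform_eventually[OF tendsto_const]) (auto simp: eventually_at_filter bump_def)
  ultimately show ?thesis by (simp add: filterlim_split_at)
qed

text \<open>With w = 1/r one has dw/dr = -w^2, hence p(w) exp(-w) has the derivative w^2 (p(w) -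
  p'(w)) exp(-w). The family \<open>bump p\<close> is thus closed under differentiation, which is
  why it carries a polynomial parameter.\<close>

definition bump_deriv :: "real poly \<Rightarrow> real poly" where
  "bump_deriv p = [:0, 0, 1:] * (p - pderiv p)"

lemma bump_has_real_derivative: "(bump p has_real_derivative bump (bump_deriv p) r) (at r)"
proof (cases r "0::real" rule: linorder_cases)
  case less
  have "(bump p has_real_derivative 0) (at r)"
    by (rule has_field_derivative_transform_within_open[of "\<lambda>_. 0" 0 r "{..<0}"])
      (use less in \<open>auto simp: bump_def\<close>)
  with less show ?thesis by (simp add: bump_def)
next
  case equal
  \<comment> \<open>At 0 the difference quotient is again a bump: division by h multiplies the
    polynomial in 1/h by its variable, so the limit comes from
    \<open>bump_tendsto_0\<close>.\<close>
  have "(\<lambda>h. (bump p h - bump p 0) / h) = bump (pCons 0 p)"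
    by (auto simp: bump_def fun_eq_iff)
  then show ?thesis
    unfolding equal DERIV_def using bump_tendsto_0[of "pCons 0 p"] by (simp add: bump_def)
next
  case greater
  define w where "w = 1 / r"
  have inv: "((\<lambda>r. 1 / r) has_real_derivative - (w\<^sup>2)) (at r)"
    using DERIV_inverse[of r UNIV] greater by (simp add: w_def inverse_eq_divide power_divide power2_eq_square)
  have 1: "((\<lambda>r. exp (- (1 / r))) has_real_derivative exp (- w) * w\<^sup>2) (at r)"
    using DERIV_chain2[OF DERIV_exp DERIV_minus[OF inv]] by (simp add: w_def)
  have 2: "((\<lambda>r. poly p (1 / r)) has_real_derivative poly (pderiv p) w * - (w\<^sup>2)) (at r)"
    using DERIV_chain2[OF poly_DERIV inv] by (simp add: w_def)
  have "bump (bump_deriv p) r = poly (bump_deriv p) w * exp (- w)"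
    using greater by (simp add: bump_def w_def)
  also have "poly (bump_deriv p) w = w\<^sup>2 * (poly p w - poly (pderiv p) w)"
    unfolding bump_deriv_def by (simp add: power2_eq_square)
  also have "\<dots> * exp (- w) = poly p w * (exp (- w) * w\<^sup>2) + (poly (pderiv p) w * - (w\<^sup>2)) * exp (- w)"
    by algebra
  finally have "((\<lambda>r. poly p (1 / r) * exp (- (1 / r))) has_real_derivative bump (bump_deriv p) r) (at r)"
    using DERIV_mult'[OF 2 1] by (simp add: w_def)
  then show ?thesis
    by (rule has_field_derivative_transform_within_open[of _ _ r "{0<..}"])
      (use greater in \<open>auto simp: bump_def\<close>)
qed

lemma continuous_on_bump: "continuous_on S (bump p)"
  by (rule DERIV_continuous_on[of S "bump p" "bump (bump_deriv p)"])
    (rule has_field_derivative_at_within[OF bump_has_real_derivative])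

text \<open>The profile is only evaluated at 1 - |x|^2/t^2, which is at most 1; a bound there is
  uniform in x and in the radius t.\<close>

lemma bump_bounded: "\<exists>C. \<forall>r\<le>1. \<bar>bump p r\<bar> \<le> C"
proof -
  have "bounded (bump p ` {0..1})"
    by (intro compact_imp_bounded compact_continuous_image continuous_on_bump compact_Icc)
  then obtain C where C: "\<And>r. r \<in> {0..1} \<Longrightarrow> \<bar>bump p r\<bar> \<le> C"
    unfolding bounded_iff real_norm_def by blast
  have "\<bar>bump p r\<bar> \<le> C" if "r \<le> 1" for r
  proof (cases "r \<ge> 0")
    case True
    with C that show ?thesis by simp
  next
    case False
    then have "bump p r = bump p 0" by (simp add: bump_def)
    with C[of 0] show ?thesis by simp
  qed
  then show ?thesis by blast
qed

section \<open>Differentiation under the integral sign\<close>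

text \<open>The mean value inequality bounds the increments of \<open>H\<close> by means of
  \<open>B\<close>, so the remainder quotients are at most \<open>2 * B\<close> and dominated
  convergence applies. The parameter space is general because the parameter will be a shift, a point
  of space and a mollification radius.\<close>

lemma has_derivative_integral_parameter:
  fixes H :: "'p::real_normed_vector \<Rightarrow> 'a \<Rightarrow> real"
  assumes f: "integrable M f" and r: "r > 0" and B: "0 \<le> B"
    and meas: "\<And>p. p \<in> ball x r \<Longrightarrow> H p \<in> borel_measurable M"
    and bounded: "\<And>y. \<bar>H x y\<bar> \<le> C"
    and der: "\<And>p y. p \<in> ball x r \<Longrightarrow> ((\<lambda>p. H p y) has_derivative H' p y) (at p)"
    and meas': "\<And>b. (\<lambda>y. H' x y b) \<in> borel_measurable M"
    and bnd: "\<And>p y b. p \<in> ball x r \<Longrightarrow> \<bar>H' p y b\<bar> \<le> B * norm b"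
  shows "((\<lambda>p. LINT y|M. f y * H p y) has_derivative (\<lambda>b. LINT y|M. f y * H' x y b)) (at x)"
proof -
  have x: "x \<in> ball x r" using r by simp
  have lip: "\<bar>H p y - H x y\<bar> \<le> B * norm (p - x)" if "p \<in> ball x r" for p y
  proof -
    have "norm (H p y - H x y) \<le> B * norm (p - x)"
    proof (rule differentiable_bound[of "ball x r" "\<lambda>p. H p y" "\<lambda>p. H' p y"])
      show "onorm (H' p y) \<le> B" if "p \<in> ball x r" for p
        using bnd[OF that] B by (intro onorm_bound) auto
      show "((\<lambda>p. H p y) has_derivative H' q y) (at q within ball x r)" if "q \<in> ball x r" for q
        using der[OF that] by (rule has_derivative_at_withinI)
    qed (use that x in auto)
    then show ?thesis by simp
  qed
  have bl: "bounded_linear (H' x y)" for y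
    using der[OF x] by (rule has_derivative_bounded_linear)
  have int': "integrable M (\<lambda>y. f y * H' x y b)" for b
  proof (rule Bochner_Integration.integrable_bound)
    show "integrable M (\<lambda>y. (B * norm b) * \<bar>f y\<bar>)" using f by auto
    show "AE y in M. norm (f y * H' x y b) \<le> norm (B * norm b * \<bar>f y\<bar>)"
    proof (rule AE_I2)
      fix y
      have "\<bar>H' x y b\<bar> \<le> \<bar>B * norm b\<bar>" using bnd[OF x, of y b] by linarith
      then have "\<bar>f y\<bar> * \<bar>H' x y b\<bar> \<le> \<bar>f y\<bar> * \<bar>B * norm b\<bar>" by (intro mult_left_mono) auto
      then show "norm (f y * H' x y b) \<le> norm (B * norm b * \<bar>f y\<bar>)"
        by (simp add: abs_mult mult_ac)
    qed
  qed (use f meas' in measurable)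
  have int: "integrable M (\<lambda>y. f y * H p y)" if p: "p \<in> ball x r" for p
  proof (rule Bochner_Integration.integrable_bound)
    show "integrable M (\<lambda>y. (C + B * norm (p - x)) * \<bar>f y\<bar>)" using f by auto
    show "AE y in M. norm (f y * H p y) \<le> norm ((C + B * norm (p - x)) * \<bar>f y\<bar>)"
    proof (rule AE_I2)
      fix y
      have "\<bar>H p y\<bar> \<le> \<bar>C + B * norm (p - x)\<bar>" using bounded[of y] lip[OF p, of y] by linarith
      then have "\<bar>f y\<bar> * \<bar>H p y\<bar> \<le> \<bar>f y\<bar> * \<bar>C + B * norm (p - x)\<bar>" by (intro mult_left_mono) auto
      then show "norm (f y * H p y) \<le> norm ((C + B * norm (p - x)) * \<bar>f y\<bar>)"
        by (simp add: abs_mult mult_ac)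
    qed
  qed (use f meas[OF p] in measurable)
  show ?thesis
    unfolding has_derivative_iff_norm
  proof (intro conjI)
    show "bounded_linear (\<lambda>b. LINT y|M. f y * H' x y b)"
    proof (rule bounded_linear_intro[where K = "(LINT y|M. \<bar>f y\<bar>) * B"])
      fix a b
      show "(LINT y|M. f y * H' x y (a + b)) = (LINT y|M. f y * H' x y a) + (LINT y|M. f y * H' x y b)"
        by (subst Bochner_Integration.integral_add[symmetric, OF int' int'])
          (simp add: linear_add[OF bounded_linear.linear[OF bl]] algebra_simps)
    next
      fix c b
      show "(LINT y|M. f y * H' x y (c *\<^sub>R b)) = c *\<^sub>R (LINT y|M. f y * H' x y b)"
        by (simp add: linear_cmul[OF bounded_linear.linear[OF bl]] mult.left_commute)
    next
      fix b
      have "norm (LINT y|M. f y * H' x y b) \<le> (LINT y|M. norm (f y * H' x y b))" by simp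
      also have "\<dots> \<le> (LINT y|M. \<bar>f y\<bar> * (B * norm b))"
        using f bnd[OF x] by (intro integral_mono integrable_norm[OF int'])
          (auto simp: abs_mult intro!: mult_left_mono)
      finally show "norm (LINT y|M. f y * H' x y b) \<le> norm b * ((LINT y|M. \<bar>f y\<bar>) * B)"
        by (simp add: mult_ac)
    qed
  next
    show "((\<lambda>p. norm ((LINT y|M. f y * H p y) - (LINT y|M. f y * H x y) - (LINT y|M. f y * H' x y (p - x)))
        / norm (p - x)) \<longlongrightarrow> 0) (at x)"
      unfolding tendsto_at_iff_sequentially
    proof (intro allI impI)
      fix X :: "nat \<Rightarrow> 'p" assume X: "\<forall>i. X i \<in> UNIV - {x}" "X \<longlonglongrightarrow> x"
      have ev: "eventually (\<lambda>n. X n \<in> ball x r) sequentially"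
        using X(2) r by (simp add: tendsto_iff dist_commute)
      then obtain N where N: "\<And>n. n \<ge> N \<Longrightarrow> X n \<in> ball x r" by (auto simp: eventually_sequentially)
      \<comment> \<open>Dropping the first N terms puts the whole sequence in the ball, where the
        bounds hold; \<open>LIMSEQ_offset\<close> restores the original sequence at the end.\<close>
      define Y where "Y n = X (n + N)" for n
      have Yb: "Y n \<in> ball x r" and Yne: "Y n \<noteq> x" for n using N X(1) by (auto simp: Y_def)
      have Y: "Y \<longlonglongrightarrow> x" unfolding Y_def using X(2) by (rule LIMSEQ_ignore_initial_segment)
      define q where "q p y = (H p y - H x y - H' x y (p - x)) / norm (p - x)" for p y
      have qb: "\<bar>q (Y n) y\<bar> \<le> 2 * B" for n y
      proof -
        have "\<bar>H (Y n) y - H x y - H' x y (Y n - x)\<bar> \<le> 2 * B * norm (Y n - x)"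
          using lip[OF Yb, of n y] bnd[OF x, of y "Y n - x"] by linarith
        then show ?thesis using Yne[of n] by (simp add: q_def abs_divide divide_le_eq)
      qed
      have "(\<lambda>n. LINT y|M. f y * q (Y n) y) \<longlonglongrightarrow> (LINT y|M. 0)"
      proof (rule integral_dominated_convergence[where w = "\<lambda>y. 2 * B * \<bar>f y\<bar>"])
        show "AE y in M. (\<lambda>n. f y * q (Y n) y) \<longlonglongrightarrow> 0"
        proof (rule AE_I2)
          fix y
          have "((\<lambda>p. norm (q p y)) \<longlongrightarrow> 0) (at x)"
            using der[OF x, of y] unfolding has_derivative_iff_norm q_def by simp
          then have "(\<lambda>n. norm (q (Y n) y)) \<longlonglongrightarrow> 0"
            using Y Yne unfolding tendsto_at_iff_sequentially comp_def by auto
          then have "(\<lambda>n. q (Y n) y) \<longlonglongrightarrow> 0" by (rule tendsto_norm_zero_cancel)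
          then show "(\<lambda>n. f y * q (Y n) y) \<longlonglongrightarrow> 0" by (rule tendsto_mult_right_zero)
        qed
        show "AE y in M. norm (f y * q (Y n) y) \<le> 2 * B * \<bar>f y\<bar>" for n
          using qb by (auto simp: abs_mult mult.commute[of "\<bar>f _\<bar>"] intro!: mult_right_mono)
        show "(\<lambda>y. f y * q (Y n) y) \<in> borel_measurable M" for n
          unfolding q_def using meas[OF Yb] meas[OF x] meas' f by measurable
      qed (use f in auto)
      then have "(\<lambda>n. \<bar>LINT y|M. f y * q (Y n) y\<bar>) \<longlonglongrightarrow> 0"
        by (simp add: tendsto_rabs_zero_iff)
      moreover have "\<bar>LINT y|M. f y * q (Y n) y\<bar> =
         norm ((LINT y|M. f y * H (Y n) y) - (LINT y|M. f y * H x y) - (LINT y|M. f y * H' x y (Y n - x)))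
          / norm (Y n - x)" for n
      proof -
        have "(LINT y|M. f y * q (Y n) y) =
          (LINT y|M. ((f y * H (Y n) y - f y * H x y) - f y * H' x y (Y n - x)) / norm (Y n - x))"
          by (simp add: q_def algebra_simps diff_divide_distrib)
        also have "\<dots> = ((LINT y|M. f y * H (Y n) y) - (LINT y|M. f y * H x y) - (LINT y|M. f y * H' x y (Y n - x))) / norm (Y n - x)"
          using int[OF Yb, of n] int[OF x] int'[of "Y n - x"] by simp
        finally show ?thesis by (simp add: abs_divide)
      qed
      ultimately show "((\<lambda>p. norm ((LINT y|M. f y * H p y) - (LINT y|M. f y * H x y) - (LINT y|M. f y * H' x y (p - x)))
        / norm (p - x)) \<circ> X) \<longlonglongrightarrow> 0"
        unfolding comp_def Y_def by - (rule LIMSEQ_offset[where k = N], simp)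
    qed
  qed
qed

subsection \<open>Gradients and test functions\<close>

definition pgrad :: "(real^'n \<Rightarrow> real) \<Rightarrow> real^'n \<Rightarrow> real^'n" where
  "pgrad f x = (\<chi> i. partial_deriv i f x)"

lemma pgrad_nth [simp]: "pgrad f x $ i = partial_deriv i f x"
  by (simp add: pgrad_def)

lemma GDERIV_pgrad:
  fixes f :: "real^'n \<Rightarrow> real"
  assumes "f differentiable (at x)"
  shows "GDERIV f x :> pgrad f x"
proof -
  define f' where "f' = frechet_derivative f (at x)"
  have f': "(f has_derivative f') (at x)"
    using assms by (simp add: f'_def frechet_derivative_works)
  have lin: "linear f'"
    using has_derivative_bounded_linear[OF f'] by (rule bounded_linear.linear)
  have "f' h = h \<bullet> pgrad f x" for h
  proof -
    have "f' h = f' (\<Sum>i\<in>UNIV. h $ i *s axis i 1)" by (simp add: basis_expansion)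
    also have "\<dots> = (\<Sum>i\<in>UNIV. h $ i * f' (axis i 1))"
      by (simp add: linear_sum[OF lin] scalar_mult_eq_scaleR linear_cmul[OF lin])
    finally show ?thesis by (simp add: inner_vec_def partial_deriv_def f'_def)
  qed
  then have "f' = (\<lambda>h. h \<bullet> pgrad f x)" by auto
  with f' show ?thesis by (simp add: gderiv_def)
qed

lemma partial_deriv_GDERIV:
  assumes "GDERIV f x :> D"
  shows "partial_deriv i f x = D $ i"
  using fun_cong[OF frechet_derivative_at[OF assms[unfolded gderiv_def]], of "axis i 1"]
  by (simp add: partial_deriv_def inner_axis')

lemma GDERIV_differentiable: "GDERIV f x :> D \<Longrightarrow> f differentiable (at x)"
  unfolding gderiv_def by (rule differentiableI)

lemma GDERIV_vec_nth: "GDERIV (\<lambda>x :: real^'n. x $ i) x :> axis i 1"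
  unfolding gderiv_def
  by (auto intro!: derivative_eq_intros bounded_linear_imp_has_derivative bounded_linear_vec_nth simp: inner_axis)

lemma GDERIV_continuous_on:
  fixes f :: "real^'n \<Rightarrow> real"
  assumes "\<And>x. GDERIV f x :> D x"
  shows "continuous_on S f"
  using assms
  by (auto intro!: differentiable_imp_continuous_on differentiable_at_withinI GDERIV_differentiable simp: differentiable_on_def)

lemma GDERIV_local_zero:
  assumes "open S" "x \<in> S" "\<And>y. y \<in> S \<Longrightarrow> f y = 0" "GDERIV f x :> D"
  shows "D = 0"
proof -
  have "GDERIV f x :> 0"
    unfolding gderiv_def using assms
    by (intro has_derivative_transform_within_open[of "\<lambda>_. 0" _ x UNIV S f]) auto
  then have "(\<lambda>h. h \<bullet> D) = (\<lambda>h. h \<bullet> 0)"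
    using assms(4) unfolding gderiv_def by (rule has_derivative_unique[rotated])
  then have "D \<bullet> D = 0" by (metis inner_zero_right)
  then show ?thesis by simp
qed

lemma times_cont_diff_imp_continuous: "times_cont_diff k f \<Longrightarrow> continuous_on UNIV f"
  by (cases k) (auto intro: differentiable_imp_continuous_on)

lemma test_functions_continuous: "\<phi> \<in> test_functions \<Omega> \<Longrightarrow> continuous_on UNIV \<phi>"
  by (auto simp: test_functions_def intro: times_cont_diff_imp_continuous)

lemma test_functions_differentiable:
  assumes "\<phi> \<in> test_functions \<Omega>"
  shows "\<phi> differentiable (at x)"
proof -
  have "times_cont_diff (Suc 0) \<phi>" using assms by (auto simp: test_functions_def)
  then show ?thesis by (simp add: differentiable_on_def)
qed

lemmas test_functions_GDERIV = GDERIV_pgrad[OF test_functions_differentiable]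

lemma test_functions_partial_deriv:
  assumes "\<phi> \<in> test_functions \<Omega>"
  shows "partial_deriv i \<phi> \<in> test_functions \<Omega>"
proof -
  let ?K = "closure {x. \<phi> x \<noteq> 0}"
  have "times_cont_diff (Suc k) \<phi>" for k using assms unfolding test_functions_def by blast
  then have 1: "times_cont_diff k (partial_deriv i \<phi>)" for k by simp
  have "partial_deriv i \<phi> x = 0" if "x \<notin> ?K" for x
  proof -
    have "pgrad \<phi> x = 0"
      using that closure_subset[of "{x. \<phi> x \<noteq> 0}"]
      by (intro GDERIV_local_zero[of "- ?K" x \<phi>] test_functions_GDERIV[OF assms]) auto
    then show ?thesis using pgrad_nth[of \<phi> x i] by simp
  qed
  then have sub: "closure {x. partial_deriv i \<phi> x \<noteq> 0} \<subseteq> ?K"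
    by (intro closure_minimal) auto
  moreover have "compact ?K" "?K \<subseteq> \<Omega>" using assms by (auto simp: test_functions_def)
  ultimately have "compact (closure {x. partial_deriv i \<phi> x \<noteq> 0})"
    by (metis compact_closure compact_imp_bounded bounded_subset closure_closure closed_closure compact_eq_bounded_closed)
  with 1 sub \<open>?K \<subseteq> \<Omega>\<close> show ?thesis by (auto simp: test_functions_def)
qed

lemma test_functions_support:
  assumes "\<phi> \<in> test_functions \<Omega>"
  obtains K where "compact K" "K \<subseteq> \<Omega>" "\<And>x. x \<notin> K \<Longrightarrow> \<phi> x = 0"
  using assms closure_subset[of "{x. \<phi> x \<noteq> 0}"] unfolding test_functions_def by blast

lemma compactly_supported_bounded:
  fixes f :: "'a::euclidean_space \<Rightarrow> real"
  assumes "continuous_on UNIV f" "compact K" "\<And>x. x \<notin> K \<Longrightarrow> f x = 0"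
  obtains B where "0 \<le> B" "\<And>x. \<bar>f x\<bar> \<le> B"
proof -
  have "bounded (f ` K)"
    using assms by (intro compact_imp_bounded compact_continuous_image) (auto intro: continuous_on_subset)
  then obtain B where B: "B > 0" "\<And>x. x \<in> K \<Longrightarrow> \<bar>f x\<bar> \<le> B"
    unfolding bounded_pos real_norm_def by blast
  have "\<bar>f x\<bar> \<le> B" for x
    using B assms(3) by (cases "x \<in> K") auto
  with B(1) that[of B] show ?thesis by simp
qed

lemma compactly_supported_integrable:
  fixes f :: "'a::euclidean_space \<Rightarrow> real"
  assumes "continuous_on UNIV f" "compact K" "\<And>x. x \<notin> K \<Longrightarrow> f x = 0"
  shows "integrable lborel f"
proof -
  have "integrable lborel (\<lambda>x. indicator K x *\<^sub>R f x)"
    using assms by (intro borel_integrable_compact) (auto intro: continuous_on_subset)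
  moreover have "(\<lambda>x. indicator K x *\<^sub>R f x) = f"
    using assms(3) by (auto simp: fun_eq_iff indicator_def)
  ultimately show ?thesis by simp
qed

lemma test_functions_bounded:
  assumes "\<phi> \<in> test_functions \<Omega>"
  obtains B where "0 \<le> B" "\<And>x. \<bar>\<phi> x\<bar> \<le> B"
  using test_functions_support[OF assms] compactly_supported_bounded[OF test_functions_continuous[OF assms]] by metis

lemma integrable_times_bounded:
  fixes f K :: "'a \<Rightarrow> real"
  assumes "integrable M f" "K \<in> borel_measurable M" "\<And>x. \<bar>K x\<bar> \<le> B"
  shows "integrable M (\<lambda>x. f x * K x)"
proof (rule Bochner_Integration.integrable_bound)
  show "integrable M (\<lambda>x. B * f x)" using assms by simp
  have "\<bar>f x * K x\<bar> \<le> \<bar>B * f x\<bar>" for x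
    using mult_left_mono[OF order_trans[OF assms(3)[of x] abs_ge_self], of "\<bar>f x\<bar>"] by (simp add: abs_mult mult.commute)
  then show "AE x in M. norm (f x * K x) \<le> norm (B * f x)" by simp
qed (use assms in measurable)

section \<open>Integration by parts with compact support\<close>

lemma lborel_integral_translate:
  fixes f :: "'a::euclidean_space \<Rightarrow> real"
  assumes "f \<in> borel_measurable borel"
  shows "(LINT x|lborel. f (a + x)) = (LINT x|lborel. f x)"
proof -
  have "(LINT x|lborel. f x) = (LINT x|distr lborel borel ((+) a). f x)"
    by (simp add: lborel_distr_plus)
  also have "\<dots> = (LINT x|lborel. f (a + x))"
    using assms by (intro integral_distr) auto
  finally show ?thesis by simp
qed

text \<open>Translation invariance: the integral of \<open>F (y + s *\<^sub>R e)\<close> does not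
  depend on s for small s, and its derivative at s = 0 is the integral in question.\<close>

lemma integral_gradient_compact_support:
  fixes F :: "real^'n \<Rightarrow> real"
  assumes F: "\<And>x. GDERIV F x :> G x" and cont: "continuous_on UNIV (\<lambda>x. G x $ i)"
    and K: "compact K" "\<And>x. x \<notin> K \<Longrightarrow> F x = 0"
  shows "(LINT x|lborel. G x $ i) = 0"
proof -
  have G0: "G x $ i = 0" if "x \<notin> K" for x
    using GDERIV_local_zero[of "- K" x F "G x"] F that K by (simp add: compact_imp_closed open_Compl)
  have cF: "continuous_on UNIV F" by (rule GDERIV_continuous_on[OF F])
  have Fm [measurable]: "F \<in> borel_measurable borel" using cF by (rule borel_measurable_continuous_onI)
  have Gm [measurable]: "(\<lambda>x. G x $ i) \<in> borel_measurable borel" using cont by (rule borel_measurable_continuous_onI)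
  obtain B where B: "0 \<le> B" "\<And>x. \<bar>G x $ i\<bar> \<le> B"
    using compactly_supported_bounded[OF cont K(1) G0] by blast
  obtain C where C: "\<And>x. \<bar>F x\<bar> \<le> C"
    using compactly_supported_bounded[OF cF K] by blast
  obtain R where R: "\<And>x. x \<in> K \<Longrightarrow> norm x \<le> R"
    using compact_imp_bounded[OF K(1)] by (auto simp: bounded_iff)
  define e :: "real^'n" where "e = axis i 1"
  have e: "norm e = 1" by (simp add: e_def)
  \<comment> \<open>Differentiation under the integral asks for an integrable factor, and the
    indicator of this ball serves as one. The extra 1 in the radius makes it equal to 1 at each y
    with y + s e in \<open>K\<close> and |s| < 1, so it does not alter the integrand.\<close>
  define f :: "real^'n \<Rightarrow> real" where "f = indicator (cball 0 (R + 1))"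
  have Kf: "f x = 1" if "x + s *\<^sub>R e \<in> K" "\<bar>s\<bar> < 1" for x s
  proof -
    have "norm x \<le> norm (x + s *\<^sub>R e) + norm (s *\<^sub>R e)" using norm_triangle_ineq4[of "x + s *\<^sub>R e" "s *\<^sub>R e"] by simp
    also have "\<dots> \<le> R + 1" using R[OF that(1)] that(2) e by simp
    finally show ?thesis by (simp add: f_def)
  qed
  have const: "(LINT y|lborel. f y * F (y + s *\<^sub>R e)) = (LINT y|lborel. F y)" if "\<bar>s\<bar> < 1" for s
  proof -
    have "f y * F (y + s *\<^sub>R e) = F (s *\<^sub>R e + y)" for y
      using Kf[of y s] that K(2)[of "y + s *\<^sub>R e"] by (cases "y + s *\<^sub>R e \<in> K") (auto simp: add.commute)
    then show ?thesis using lborel_integral_translate[OF Fm] by simp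
  qed
  have der: "((\<lambda>s. LINT y|lborel. f y * F (y + s *\<^sub>R e)) has_derivative
      (\<lambda>b. LINT y|lborel. f y * (b * G (y + 0 *\<^sub>R e) $ i))) (at 0)"
  proof (rule has_derivative_integral_parameter[where H = "\<lambda>s y. F (y + s *\<^sub>R e)" and r = 1 and C = C and B = B
        and H' = "\<lambda>s y b. b * G (y + s *\<^sub>R e) $ i"])
    show "integrable lborel f" unfolding f_def
      using emeasure_bounded_finite[of "cball (0 :: real^'n) (R + 1)"] by (intro integrable_real_indicator) auto
    show "((\<lambda>s. F (y + s *\<^sub>R e)) has_derivative (\<lambda>b. b * G (y + s *\<^sub>R e) $ i)) (at s)" for s y
    proof -
      have "((\<lambda>s. F (y + s *\<^sub>R e)) has_derivative (\<lambda>b. (b *\<^sub>R e) \<bullet> G (y + s *\<^sub>R e))) (at s)"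
        using F[unfolded gderiv_def] by (rule has_derivative_compose[rotated]) (auto intro!: derivative_eq_intros)
      then show ?thesis by (simp add: e_def inner_axis')
    qed
    show "\<bar>b * G (y + s *\<^sub>R e) $ i\<bar> \<le> B * norm b" for s y b
      using mult_right_mono[OF B(2), of "\<bar>b\<bar>"] by (simp add: abs_mult mult.commute)
  qed (use B(1) C in auto)
  have "((\<lambda>s. LINT y|lborel. f y * F (y + s *\<^sub>R e)) has_derivative (\<lambda>b. 0)) (at 0)"
    by (rule has_derivative_transform_within_open[of "\<lambda>_. LINT y|lborel. F y" _ 0 UNIV "ball 0 1"])
      (auto simp: const)
  from has_derivative_unique[OF der this]
  have "(LINT y|lborel. f y * (1 * G (y + 0 *\<^sub>R e) $ i)) = 0" by (rule fun_cong)
  moreover have "f y * (1 * G (y + 0 *\<^sub>R e) $ i) = G y $ i" for y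
    using Kf[of y 0] G0[of y] by (cases "y \<in> K") auto
  ultimately show ?thesis by (simp only:)
qed

lemma integration_by_parts_partial:
  fixes F \<phi> :: "real^'n \<Rightarrow> real"
  assumes F: "\<And>x. GDERIV F x :> G x" "continuous_on UNIV (\<lambda>x. G x $ i)"
    and \<phi>: "\<And>x. GDERIV \<phi> x :> D x" "continuous_on UNIV (\<lambda>x. D x $ i)"
    and K: "compact K" "\<And>x. x \<notin> K \<Longrightarrow> \<phi> x = 0"
  shows "(LINT x|lborel. F x * D x $ i) = - (LINT x|lborel. G x $ i * \<phi> x)"
proof -
  have cF: "continuous_on UNIV F" and c\<phi>: "continuous_on UNIV \<phi>"
    by (rule GDERIV_continuous_on[OF F(1)], rule GDERIV_continuous_on[OF \<phi>(1)])
  have D0: "D x $ i = 0" if "x \<notin> K" for x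
    using GDERIV_local_zero[of "- K" x \<phi> "D x"] \<phi> that K by (simp add: compact_imp_closed open_Compl)
  have "(LINT x|lborel. (F x *\<^sub>R D x + \<phi> x *\<^sub>R G x) $ i) = 0"
    by (rule integral_gradient_compact_support[OF GDERIV_mult[OF F(1) \<phi>(1)] _ K(1)])
      (auto intro!: continuous_intros cF c\<phi> F \<phi> simp: K(2))
  moreover have "integrable lborel (\<lambda>x. F x * D x $ i)" "integrable lborel (\<lambda>x. \<phi> x * G x $ i)"
    by (rule compactly_supported_integrable[OF _ K(1)]; auto intro!: continuous_intros cF c\<phi> F \<phi> simp: K(2) D0)+
  ultimately show ?thesis by (simp add: mult.commute)
qed

section \<open>Convolution with test functions\<close>

text \<open>The kernel is evaluated at y - x rather than x - y, so that \<open>conv f K x\<close> is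
  literally the pairing of \<open>f\<close> with a translated test function; the price is a minus
  sign in each derivative.\<close>

definition conv :: "(real^'n \<Rightarrow> real) \<Rightarrow> (real^'n \<Rightarrow> real) \<Rightarrow> real^'n \<Rightarrow> real" where
  "conv f K x = (LINT y|lborel. f y * K (y - x))"

lemma conv_GDERIV:
  fixes f K :: "real^'n \<Rightarrow> real"
  assumes f: "integrable lborel f" and K: "K \<in> test_functions \<Omega>"
  shows "GDERIV (conv f K) x :> (\<chi> i. - conv f (partial_deriv i K) x)"
proof -
  have K': "partial_deriv i K \<in> test_functions \<Omega>" for i by (rule test_functions_partial_deriv[OF K])
  have [measurable]: "K \<in> borel_measurable borel" "\<And>i. partial_deriv i K \<in> borel_measurable borel"
    using test_functions_continuous[OF K] test_functions_continuous[OF K'] by (auto intro: borel_measurable_continuous_onI)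
  obtain C where C: "\<And>x. \<bar>K x\<bar> \<le> C" using test_functions_bounded[OF K] by blast
  have "\<exists>B\<ge>0. \<forall>x. \<bar>partial_deriv i K x\<bar> \<le> B" for i using test_functions_bounded[OF K', of i] by metis
  then obtain B where B: "\<And>i. B i \<ge> 0" "\<And>i x. \<bar>partial_deriv i K x\<bar> \<le> B i" by metis
  have nB: "norm (pgrad K x) \<le> (\<Sum>i\<in>UNIV. B i)" for x
    by (rule order_trans[OF norm_le_l1_cart]) (auto intro!: sum_mono B)
  have int: "integrable lborel (\<lambda>y. f y * partial_deriv i K (y - x))" for i
    by (rule integrable_times_bounded[OF f _ B(2)]) measurable
  have "((\<lambda>x. LINT y|lborel. f y * K (y - x)) has_derivative
     (\<lambda>b. LINT y|lborel. f y * - (b \<bullet> pgrad K (y - x)))) (at x)"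
  proof (rule has_derivative_integral_parameter[where r = 1 and C = C and B = "\<Sum>i\<in>UNIV. B i", OF f])
    show "((\<lambda>x. K (y - x)) has_derivative (\<lambda>b. - (b \<bullet> pgrad K (y - x)))) (at x)" for x y
    proof -
      have "((\<lambda>x. K (y - x)) has_derivative (\<lambda>b. (- b) \<bullet> pgrad K (y - x))) (at x)"
        using test_functions_GDERIV[OF K, unfolded gderiv_def]
        by (rule has_derivative_compose[rotated]) (auto intro!: derivative_eq_intros)
      then show ?thesis by simp
    qed
    show "(\<lambda>y. - (b \<bullet> pgrad K (y - x))) \<in> borel_measurable lborel" for b
      unfolding inner_vec_def by simp
    show "\<bar>- (b \<bullet> pgrad K (y - x))\<bar> \<le> (\<Sum>i\<in>UNIV. B i) * norm b" for x y b
      using order_trans[OF Cauchy_Schwarz_ineq2[of b "pgrad K (y - x)"] mult_left_mono[OF nB[of "y - x"] norm_ge_zero[of b]]]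
      by (simp add: mult.commute)
  qed (use C B in \<open>auto intro: sum_nonneg\<close>)
  moreover have "(LINT y|lborel. f y * - (b \<bullet> pgrad K (y - x))) = b \<bullet> (\<chi> i. - conv f (partial_deriv i K) x)" for b
  proof -
    have "(LINT y|lborel. f y * - (b \<bullet> pgrad K (y - x)))
      = (LINT y|lborel. (\<Sum>i\<in>UNIV. - b $ i * (f y * partial_deriv i K (y - x))))"
      by (simp add: inner_vec_def sum_distrib_left sum_negf mult_ac)
    also have "\<dots> = (\<Sum>i\<in>UNIV. - b $ i * conv f (partial_deriv i K) x)"
      unfolding conv_def using int by (subst Bochner_Integration.integral_sum) auto
    finally show ?thesis by (simp add: inner_vec_def)
  qed
  ultimately show ?thesis unfolding gderiv_def conv_def by simp
qed

lemma conv_continuous: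
  assumes "integrable lborel f" "K \<in> test_functions \<Omega>"
  shows "continuous_on UNIV (conv f K)"
  by (rule GDERIV_continuous_on[OF conv_GDERIV[OF assms]])

lemma GDERIV_translate:
  fixes f :: "real^'n \<Rightarrow> real"
  assumes "GDERIV f (y - a) :> D"
  shows "GDERIV (\<lambda>y. f (y - a)) y :> D"
proof -
  have "((\<lambda>y. y - a) has_derivative (\<lambda>h. h)) (at y)" by (auto intro!: derivative_eq_intros)
  from has_derivative_compose[OF this assms[unfolded gderiv_def]] show ?thesis by (simp add: gderiv_def)
qed

lemma partial_deriv_translate:
  assumes "f differentiable_on UNIV"
  shows "partial_deriv i (\<lambda>y. f (y - a)) = (\<lambda>y. partial_deriv i f (y - a))"
proof
  fix y
  have "f differentiable at (y - a)" using assms by (auto simp: differentiable_on_def)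
  from partial_deriv_GDERIV[OF GDERIV_translate[OF GDERIV_pgrad[OF this]]]
  show "partial_deriv i (\<lambda>y. f (y - a)) y = partial_deriv i f (y - a)" by simp
qed

lemma times_cont_diff_translate: "times_cont_diff k f \<Longrightarrow> times_cont_diff k (\<lambda>y. f (y - a))"
proof (induction k arbitrary: f)
  case 0
  then show ?case by (auto intro!: continuous_intros intro: continuous_on_compose2[of UNIV f])
next
  case (Suc k)
  have "(\<lambda>y. f (y - a)) differentiable (at y)" for y
  proof -
    have "f differentiable at (y - a)" using Suc.prems by (auto simp: differentiable_on_def)
    then show ?thesis by (rule GDERIV_differentiable[OF GDERIV_translate[OF GDERIV_pgrad]])
  qed
  with Suc show ?case by (simp add: partial_deriv_translate differentiable_on_def)
qed

lemma test_functions_translate: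
  assumes \<phi>: "\<phi> \<in> test_functions S" and K: "compact K" "K \<subseteq> \<Omega>" "\<And>y. y \<notin> K \<Longrightarrow> \<phi> (y - a) = 0"
  shows "(\<lambda>y. \<phi> (y - a)) \<in> test_functions \<Omega>"
proof -
  have sub: "closure {y. \<phi> (y - a) \<noteq> 0} \<subseteq> K"
    using K by (intro closure_minimal compact_imp_closed) auto
  then have "compact (closure {y. \<phi> (y - a) \<noteq> 0})"
    using K(1) by (meson closed_closure compact_Int_closed inf.absorb_iff2 compact_imp_bounded bounded_subset compact_eq_bounded_closed)
  with sub K \<phi> show ?thesis by (auto simp: test_functions_def times_cont_diff_translate)
qed

section \<open>Smooth compactly supported radial functions\<close>

definition radial :: "real \<Rightarrow> real poly \<Rightarrow> real^'n \<Rightarrow> real" where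
  "radial t p x = bump p (1 - (norm x)\<^sup>2 / t\<^sup>2)"

lemma radial_GDERIV:
  "GDERIV (radial t p) x :> (- (2 / t\<^sup>2) * radial t (bump_deriv p) x) *\<^sub>R x"
proof -
  have "GDERIV (\<lambda>x. 1 - (x \<bullet> x) * c) x :> - (2 * c) *\<^sub>R x" for c
    unfolding gderiv_def by (auto intro!: derivative_eq_intros simp: fun_eq_iff inner_commute)
  from this[of "1 / t\<^sup>2"] have "GDERIV (\<lambda>x. 1 - (norm x)\<^sup>2 / t\<^sup>2) x :> - (2 / t\<^sup>2) *\<^sub>R x"
    by (simp add: power2_norm_eq_inner)
  from GDERIV_DERIV_compose[OF this bump_has_real_derivative, of p]
  show ?thesis by (simp add: radial_def[abs_def] mult.commute)
qed

lemma partial_deriv_radial: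
  "partial_deriv i (radial t p) = (\<lambda>x. - (2 / t\<^sup>2) * radial t (bump_deriv p) x * x $ i)"
  by (auto simp: partial_deriv_GDERIV[OF radial_GDERIV])

lemma radial_eq_0:
  assumes "0 < t" "t \<le> norm x"
  shows "radial t p x = 0"
proof -
  have "1 \<le> (norm x)\<^sup>2 / t\<^sup>2"
    using assms power_mono[OF assms(2), of 2] by (simp add: le_divide_eq)
  then show ?thesis by (simp add: radial_def bump_def)
qed

text \<open>The partial derivatives of a radial bump are no longer radial, but they stay in the
  algebra generated by constants, coordinates and radial bumps. This algebra is closed under partial
  derivatives, so smoothness of every order follows by one induction.\<close>

inductive_set radial_algebra :: "real \<Rightarrow> (real^'n \<Rightarrow> real) set" for t where
  const: "(\<lambda>x. c) \<in> radial_algebra t"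
| coord: "(\<lambda>x. x $ i) \<in> radial_algebra t"
| radial: "radial t p \<in> radial_algebra t"
| add: "f \<in> radial_algebra t \<Longrightarrow> g \<in> radial_algebra t \<Longrightarrow> (\<lambda>x. f x + g x) \<in> radial_algebra t"
| mult: "f \<in> radial_algebra t \<Longrightarrow> g \<in> radial_algebra t \<Longrightarrow> (\<lambda>x. f x * g x) \<in> radial_algebra t"

lemma radial_algebra_gradient:
  fixes f :: "real^'n \<Rightarrow> real"
  assumes "f \<in> radial_algebra t"
  shows "\<exists>D. (\<forall>x. GDERIV f x :> D x) \<and> (\<forall>i. (\<lambda>x. D x $ i) \<in> radial_algebra t)"
  using assms
proof induction
  case (const c)
  show ?case by (rule exI[of _ "\<lambda>_. 0"]) (auto intro: GDERIV_const radial_algebra.const)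
next
  case (coord i)
  have "GDERIV (\<lambda>x::real^'n. x $ i) x :> axis i 1" for x by (rule GDERIV_vec_nth)
  moreover have "(\<lambda>x. axis i 1 $ j) \<in> radial_algebra t" for j by (rule radial_algebra.const)
  ultimately show ?case by (intro exI[of _ "\<lambda>_. axis i 1"]) auto
next
  case (radial p)
  have "(\<lambda>x. (- (2 / t\<^sup>2) * radial t (bump_deriv p) x) * x $ i) \<in> radial_algebra t" for i
    by (intro radial_algebra.intros)
  with radial_GDERIV show ?case
    by (intro exI[of _ "\<lambda>x. (- (2 / t\<^sup>2) * radial t (bump_deriv p) x) *\<^sub>R x"]) auto
next
  case (add f g)
  then obtain D E where "\<And>x. GDERIV f x :> D x" "\<And>i. (\<lambda>x. D x $ i) \<in> radial_algebra t"
    "\<And>x. GDERIV g x :> E x" "\<And>i. (\<lambda>x. E x $ i) \<in> radial_algebra t" by blast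
  then show ?case
    by (intro exI[of _ "\<lambda>x. D x + E x"]) (auto intro: GDERIV_add radial_algebra.add)
next
  case (mult f g)
  then obtain D E where "\<And>x. GDERIV f x :> D x" "\<And>i. (\<lambda>x. D x $ i) \<in> radial_algebra t"
    "\<And>x. GDERIV g x :> E x" "\<And>i. (\<lambda>x. E x $ i) \<in> radial_algebra t" by blast
  with mult.hyps show ?case
    by (intro exI[of _ "\<lambda>x. f x *\<^sub>R E x + g x *\<^sub>R D x"]) (auto intro: GDERIV_mult intro!: radial_algebra.add radial_algebra.mult)
qed

lemma radial_algebra_smooth: "f \<in> radial_algebra t \<Longrightarrow> times_cont_diff k f"
proof (induction k arbitrary: f)
  case 0
  then obtain D where "\<And>x. GDERIV f x :> D x" using radial_algebra_gradient by blast
  then show ?case by (auto intro: GDERIV_continuous_on)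
next
  case (Suc k)
  then obtain D where D: "\<And>x. GDERIV f x :> D x" "\<And>i. (\<lambda>x. D x $ i) \<in> radial_algebra t"
    using radial_algebra_gradient by blast
  have "partial_deriv i f = (\<lambda>x. D x $ i)" for i using partial_deriv_GDERIV[OF D(1)] by auto
  with D Suc.IH show ?case by (auto intro: GDERIV_differentiable simp: differentiable_on_def)
qed

lemma radial_algebra_test_function:
  fixes f :: "real^'n \<Rightarrow> real"
  assumes "f \<in> radial_algebra t" "\<And>y. t \<le> norm y \<Longrightarrow> f y = 0"
  shows "f \<in> test_functions UNIV"
proof -
  have sub: "closure {y. f y \<noteq> 0} \<subseteq> cball 0 t"
  proof (intro closure_minimal subsetI)
    fix y assume "y \<in> {y. f y \<noteq> 0}"
    then have "\<not> t \<le> norm y" using assms(2) by auto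
    then show "y \<in> cball 0 t" by simp
  qed simp
  then have "compact (closure {y. f y \<noteq> 0})"
    using bounded_subset[OF bounded_cball sub] by (simp add: compact_eq_bounded_closed)
  then show ?thesis by (auto simp: test_functions_def radial_algebra_smooth[OF assms(1)])
qed

lemma radial_test_function: "0 < t \<Longrightarrow> radial t p \<in> test_functions UNIV"
  by (rule radial_algebra_test_function[OF radial_algebra.radial radial_eq_0])

lemma radial_translate_test_function:
  assumes "0 < t" "cball x t \<subseteq> \<Omega>"
  shows "(\<lambda>y. radial t p (y - x)) \<in> test_functions \<Omega>"
  by (rule test_functions_translate[OF radial_test_function[OF assms(1)] compact_cball assms(2)])
    (auto intro!: radial_eq_0 assms(1) simp: dist_norm norm_minus_commute)

subsection \<open>Radial mollifiers\<close>

lemma radial_bounded: "\<exists>C\<ge>0. \<forall>t (x :: real^'n). \<bar>radial t p x\<bar> \<le> C"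
proof -
  obtain C where C: "\<And>r. r \<le> 1 \<Longrightarrow> \<bar>bump p r\<bar> \<le> C" using bump_bounded by blast
  moreover have "0 \<le> C" using C[of 0] by simp
  ultimately show ?thesis by (auto simp: radial_def intro!: exI[of _ C])
qed

lemma radial_integrable: "0 < t \<Longrightarrow> integrable lborel (radial t p :: real^'n \<Rightarrow> real)"
  by (rule compactly_supported_integrable[OF test_functions_continuous[OF radial_test_function] compact_cball[of 0 t]])
    (auto intro: radial_eq_0)

text \<open>The substitution y = t z. Normalising \<open>radial t p\<close> thus amounts to division
  by t^n and by a constant free of t, the form in which the scale derivative is computed.\<close>

lemma integral_radial:
  assumes "0 < t"
  shows "(LINT y|lborel. radial t p (y :: real^'n)) = t ^ CARD('n) * (LINT y|lborel. radial 1 p (y :: real^'n))"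
proof -
  have [measurable]: "(radial t p :: real^'n \<Rightarrow> real) \<in> borel_measurable borel"
    using borel_measurable_integrable[OF radial_integrable[OF assms]] by simp
  have "(LINT y|lborel. radial t p (y :: real^'n))
    = (LINT y|density (distr lborel borel (\<lambda>x. 0 + t *\<^sub>R x)) (\<lambda>_. \<bar>t\<bar> ^ DIM(real^'n)). radial t p (y :: real^'n))"
    using assms by (subst lborel_affine[of t 0]) auto
  also have "\<dots> = (LINT y|lborel. t ^ CARD('n) * radial t p (t *\<^sub>R y :: real^'n))"
    using assms by (subst integral_density) (auto simp: integral_distr)
  also have "\<dots> = t ^ CARD('n) * (LINT y|lborel. radial 1 p (y :: real^'n))"
    using assms by (simp add: radial_def power_mult_distrib)
  finally show ?thesis .
qed

lemma radial_pos:
  fixes x :: "real^'n"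
  assumes "0 < t"
  shows "0 \<le> radial t (bump_deriv 1) x" "norm x < t \<Longrightarrow> 0 < radial t (bump_deriv 1) x"
proof -
  show "0 \<le> radial t (bump_deriv 1) x"
    by (simp add: radial_def bump_def bump_deriv_def)
  assume "norm x < t"
  then have "(norm x)\<^sup>2 < t\<^sup>2" using assms by (intro power_strict_mono) auto
  then have "0 < 1 - (norm x)\<^sup>2 / t\<^sup>2" using assms by (simp add: divide_less_eq)
  then show "0 < radial t (bump_deriv 1) x"
    by (simp add: radial_def bump_def bump_deriv_def)
qed

text \<open>If the integral of this nonnegative function vanished, the open ball of radius t, on
  which the function is positive, would be a null set.\<close>

lemma integral_radial_pos:
  assumes "0 < t"
  shows "0 < (LINT y|lborel. radial t (bump_deriv 1) (y :: real^'n))"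
proof -
  let ?f = "radial t (bump_deriv 1) :: real^'n \<Rightarrow> real"
  have "(LINT y|lborel. ?f y) \<noteq> 0"
  proof
    assume "(LINT y|lborel. ?f y) = 0"
    then have "AE y in lborel. ?f y = 0"
      using radial_pos(1)[OF assms] by (subst (asm) integral_nonneg_eq_0_iff_AE[OF radial_integrable[OF assms]]) auto
    then have "AE y in lborel. y \<notin> ball (0 :: real^'n) t"
      by eventually_elim (use radial_pos(2)[OF assms] in \<open>force simp: dist_norm\<close>)
    then have "emeasure lborel (ball (0 :: real^'n) t) = 0"
      by (subst (asm) AE_iff_measurable[where N = "ball (0 :: real^'n) t"]) auto
    then have "measure lborel (ball (0 :: real^'n) t) = 0" by (simp add: measure_def)
    then show False using content_ball_pos[OF assms, of "0 :: real^'n"] by simp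
  qed
  moreover have "0 \<le> (LINT y|lborel. ?f y)" by (simp add: radial_pos(1)[OF assms])
  ultimately show ?thesis by simp
qed

text \<open>The profile is r^-2 exp(-1/r) instead of exp(-1/r): being the derivative of the latter,
  it makes the scale derivative of the mollifier a multiple of the Laplacian of
  \<open>radial t 1\<close>.\<close>

definition moll :: "real \<Rightarrow> real^'n \<Rightarrow> real" where
  "moll t x = 1 / (LINT y|lborel. radial t (bump_deriv 1) (y :: real^'n)) * radial t (bump_deriv 1) x"

context
  fixes t :: real
  assumes t: "0 < t"
begin

lemma moll_eq_0: "t \<le> norm x \<Longrightarrow> moll t x = 0"
  by (simp add: moll_def radial_eq_0[OF t])

lemma moll_test_function: "(moll t :: real^'n \<Rightarrow> real) \<in> test_functions UNIV"
  by (rule radial_algebra_test_function[where t = t])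
    (auto simp only: moll_def[abs_def] radial_eq_0[OF t] mult_zero_right
      intro!: radial_algebra.const radial_algebra.radial radial_algebra.mult)

lemma moll_translate_test_function:
  "cball x t \<subseteq> \<Omega> \<Longrightarrow> (\<lambda>y. moll t (y - x)) \<in> test_functions \<Omega>"
  by (rule test_functions_translate[OF moll_test_function compact_cball])
    (auto intro!: moll_eq_0 simp: dist_norm norm_minus_commute)

lemma moll_nonneg: "0 \<le> moll t (x :: real^'n)"
  using integral_radial_pos[OF t, where 'n = 'n] radial_pos(1)[OF t, of x] by (simp add: moll_def)

lemma moll_integrable: "integrable lborel (moll t)"
  unfolding moll_def[abs_def] by (intro integrable_mult_right radial_integrable[OF t])

lemma moll_measurable [measurable]: "moll t \<in> borel_measurable borel"
  using borel_measurable_integrable[OF moll_integrable] by simp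

lemma integral_moll: "(LINT x|lborel. moll t (x :: real^'n)) = 1"
  unfolding moll_def[abs_def] using integral_radial_pos[OF t, where 'n = 'n] by simp

lemma integral_moll_translate: "(LINT y|lborel. moll t (y - x :: real^'n)) = 1"
  using lborel_integral_translate[OF moll_measurable, of "- x"] integral_moll[where 'n = 'n] by simp

lemma moll_translate_integrable: "integrable lborel (\<lambda>y. moll t (y - x :: real^'n))"
  using integral_moll_translate[of x] not_integrable_integral_eq by fastforce

lemma moll_bounded: "\<exists>C. \<forall>x :: real^'n. \<bar>moll t x\<bar> \<le> C"
  using test_functions_bounded[OF moll_test_function[where 'n = 'n]] by metis

end

section \<open>Second derivatives and scale derivatives of radial functions\<close>

lemma partial_deriv_radial_coord:
  "partial_deriv i (\<lambda>x :: real^'n. c * radial t p x * x $ j) x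
    = c * (- (2 / t\<^sup>2) * radial t (bump_deriv p) x * x $ i * x $ j + (if i = j then radial t p x else 0))"
proof -
  have "GDERIV (\<lambda>x :: real^'n. c * radial t p x * x $ j) x :>
    (c * radial t p x) *\<^sub>R axis j 1 + x $ j *\<^sub>R (c *\<^sub>R ((- (2 / t\<^sup>2) * radial t (bump_deriv p) x) *\<^sub>R x) + radial t p x *\<^sub>R 0)"
    by (intro GDERIV_mult GDERIV_vec_nth radial_GDERIV GDERIV_const)
  from partial_deriv_GDERIV[OF this, of i] show ?thesis
    by (auto simp: axis_def algebra_simps)
qed

lemma partial_deriv2_radial:
  "partial_deriv i (partial_deriv j (radial t p)) (x :: real^'n)
    = - (2 / t\<^sup>2) * (- (2 / t\<^sup>2) * radial t (bump_deriv (bump_deriv p)) x * x $ i * x $ j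
        + (if i = j then radial t (bump_deriv p) x else 0))"
  unfolding partial_deriv_radial partial_deriv_radial_coord ..

lemma laplacian_radial:
  "(\<Sum>i\<in>UNIV. partial_deriv i (partial_deriv i (radial t p)) (x :: real^'n))
    = 2 / t\<^sup>2 * (2 / t\<^sup>2 * radial t (bump_deriv (bump_deriv p)) x * (norm x)\<^sup>2 - CARD('n) * radial t (bump_deriv p) x)"
proof -
  have "(\<Sum>i\<in>UNIV. partial_deriv i (partial_deriv i (radial t p)) (x :: real^'n))
    = (\<Sum>i\<in>UNIV. 2 / t\<^sup>2 * (2 / t\<^sup>2 * radial t (bump_deriv (bump_deriv p)) x * (x $ i)\<^sup>2 - radial t (bump_deriv p) x))"
    unfolding partial_deriv2_radial by (intro sum.cong refl) (simp add: algebra_simps power2_eq_square)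
  also have "\<dots> = 2 / t\<^sup>2 * (2 / t\<^sup>2 * radial t (bump_deriv (bump_deriv p)) x * (\<Sum>i\<in>UNIV. (x $ i)\<^sup>2) - CARD('n) * radial t (bump_deriv p) x)"
    by (simp only: sum_distrib_left[symmetric] sum_subtractf sum_constant)
  also have "(\<Sum>i\<in>UNIV. (x $ i)\<^sup>2) = (norm x)\<^sup>2"
    by (simp add: norm_vec_def L2_set_def sum_nonneg)
  finally show ?thesis .
qed

lemma partial_deriv_moll:
  "partial_deriv i (moll t) = (\<lambda>x :: real^'n. 1 / (LINT y|lborel. radial t (bump_deriv 1) (y :: real^'n)) *
     (- (2 / t\<^sup>2) * radial t (bump_deriv (bump_deriv 1)) x * x $ i))"
proof
  fix x :: "real^'n"
  have "GDERIV (moll t) x :> (1 / (LINT y|lborel. radial t (bump_deriv 1) (y :: real^'n))) *\<^sub>R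
      ((- (2 / t\<^sup>2) * radial t (bump_deriv (bump_deriv 1)) x) *\<^sub>R x)"
    using GDERIV_mult[OF GDERIV_const radial_GDERIV, of "1 / (LINT y|lborel. radial t (bump_deriv 1) (y :: real^'n))"]
    by (simp add: moll_def[abs_def])
  from partial_deriv_GDERIV[OF this] show "partial_deriv i (moll t) x = 1 / (LINT y|lborel. radial t (bump_deriv 1) (y :: real^'n)) *
     (- (2 / t\<^sup>2) * radial t (bump_deriv (bump_deriv 1)) x * x $ i)" by simp
qed

text \<open>The symmetry is read off the closed form. It becomes the vanishing curl of the mollified
  gradient in the Caccioppoli estimate.\<close>

lemma partial_deriv_moll_commute:
  "partial_deriv i (partial_deriv j (moll t)) x = partial_deriv j (partial_deriv i (moll t)) (x :: real^'n)"
proof -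
  define m where "m = 1 / (LINT y|lborel. radial t (bump_deriv 1) (y :: real^'n)) * - (2 / t\<^sup>2)"
  have m: "partial_deriv i (moll t) = (\<lambda>x :: real^'n. m * radial t (bump_deriv (bump_deriv 1)) x * x $ i)" for i
    unfolding partial_deriv_moll m_def by (simp add: mult.assoc)
  show ?thesis unfolding m partial_deriv_radial_coord by (simp add: mult_ac)
qed

text \<open>For n the dimension and with \<open>bump_deriv p\<close> in place of \<open>p\<close>,
  the numerator is the bracket in \<open>laplacian_radial\<close>; the independence of the radius
  rests on this coincidence.\<close>

lemma radial_deriv_scale:
  assumes "0 < t"
  shows "((\<lambda>t. radial t p x / t ^ n) has_real_derivative
    (2 / t\<^sup>2 * radial t (bump_deriv p) x * (norm x)\<^sup>2 - n * radial t p x) / t ^ (n + 1)) (at t)"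
proof -
  have "((\<lambda>t. 1 - (norm x)\<^sup>2 / t\<^sup>2) has_real_derivative 2 * (norm x)\<^sup>2 / t ^ 3) (at t)"
    using assms by (auto intro!: derivative_eq_intros simp: power2_eq_square power3_eq_cube field_simps)
  from DERIV_chain2[OF bump_has_real_derivative this, of p]
  have 1: "((\<lambda>t. radial t p x) has_real_derivative radial t (bump_deriv p) x * (2 * (norm x)\<^sup>2 / t ^ 3)) (at t)"
    unfolding radial_def .
  have 2: "((\<lambda>t. t ^ n) has_real_derivative n * t ^ (n - 1)) (at t)"
    using DERIV_pow[of n t UNIV] by simp
  have "((\<lambda>t. radial t p x / t ^ n) has_real_derivative
     (radial t (bump_deriv p) x * (2 * (norm x)\<^sup>2 / t ^ 3) * t ^ n - radial t p x * (n * t ^ (n - 1))) / (t ^ n * t ^ n)) (at t)"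
    using assms by (intro DERIV_divide 1 2) auto
  also have "(radial t (bump_deriv p) x * (2 * (norm x)\<^sup>2 / t ^ 3) * t ^ n - radial t p x * (n * t ^ (n - 1))) / (t ^ n * t ^ n)
    = (2 / t\<^sup>2 * radial t (bump_deriv p) x * (norm x)\<^sup>2 - n * radial t p x) / t ^ (n + 1)"
    using assms by (cases n) (auto simp: field_simps power2_eq_square power3_eq_cube)
  finally show ?thesis .
qed

text \<open>Weyl's lemma in integrated form: the \<open>t\<close>-derivative of the mollifier \<open>moll t\<close> is the Laplacian of a
  test function.\<close>

lemma conv_moll_independent:
  fixes f :: "real^'n \<Rightarrow> real"
  assumes f: "integrable lborel f" and \<Omega>: "cball x t \<subseteq> \<Omega>" and s: "0 < s" "s \<le> t"
    and harmonic: "\<And>\<tau>. 0 < \<tau> \<Longrightarrow> cball x \<tau> \<subseteq> \<Omega> \<Longrightarrow>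
       (LINT y|lborel. f y * (\<Sum>i\<in>UNIV. partial_deriv i (partial_deriv i (\<lambda>y. radial \<tau> 1 (y - x))) y)) = 0"
  shows "conv f (moll s) x = conv f (moll t) x"
proof -
  define q :: "real poly" where "q = bump_deriv 1"
  define n where "n = CARD('n)"
  define H where "H \<tau> y = radial \<tau> q (y - x) / \<tau> ^ n" for \<tau> and y :: "real^'n"
  define H' where "H' \<tau> y = (2 / \<tau>\<^sup>2 * radial \<tau> (bump_deriv q) (y - x) * (norm (y - x))\<^sup>2 - n * radial \<tau> q (y - x)) / \<tau> ^ (n + 1)"
    for \<tau> and y :: "real^'n"
  obtain C where C: "0 \<le> C" "\<And>t (x :: real^'n). \<bar>radial t q x\<bar> \<le> C" using radial_bounded by metis
  obtain C' where C': "0 \<le> C'" "\<And>t (x :: real^'n). \<bar>radial t (bump_deriv q) x\<bar> \<le> C'" using radial_bounded by metis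
  have meas: "(radial \<tau> p :: real^'n \<Rightarrow> real) \<in> borel_measurable borel" if "0 < \<tau>" for \<tau> p
    using borel_measurable_integrable[OF radial_integrable[OF that]] by simp
  have der: "((\<lambda>\<tau>. LINT y|lborel. f y * H \<tau> y) has_derivative (\<lambda>b. LINT y|lborel. f y * (b * H' \<tau> y))) (at \<tau>)"
    if \<tau>: "0 < \<tau>" for \<tau>
  \<comment> \<open>On the ball of radius \<tau>/2 about \<tau> all radii exceed \<tau>/2, which
    controls the negative powers of the radius; \<open>2 * C' + n * C\<close> bounds the numerator
    of \<open>H'\<close>.\<close>
  proof (rule has_derivative_integral_parameter[where r = "\<tau> / 2" and C = "C / \<tau> ^ n" and B = "(2 * C' + n * C) / (\<tau> / 2) ^ (n + 1)"
        and H' = "\<lambda>\<tau> y b. b * H' \<tau> y", OF f])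
    have pos: "\<tau> / 2 < \<sigma>" if "\<sigma> \<in> ball \<tau> (\<tau> / 2)" for \<sigma>
      using that unfolding mem_ball dist_real_def by arith
    show "H \<sigma> \<in> borel_measurable lborel" if "\<sigma> \<in> ball \<tau> (\<tau> / 2)" for \<sigma>
      unfolding H_def using meas[of \<sigma> q] pos[OF that] \<tau> by simp
    show "(\<lambda>y. b * H' \<tau> y) \<in> borel_measurable lborel" for b
      unfolding H'_def using meas[OF \<tau>, of q] meas[OF \<tau>, of "bump_deriv q"] by simp
    show "\<bar>H \<tau> y\<bar> \<le> C / \<tau> ^ n" for y
      using C \<tau> by (simp add: H_def abs_divide divide_right_mono)
    show "((\<lambda>\<tau>. H \<tau> y) has_derivative (\<lambda>b. b * H' \<sigma> y)) (at \<sigma>)" if "\<sigma> \<in> ball \<tau> (\<tau> / 2)" for \<sigma> y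
    proof -
      have "((\<lambda>\<tau>. H \<tau> y) has_real_derivative H' \<sigma> y) (at \<sigma>)"
        unfolding H_def H'_def using pos[OF that] \<tau> by (intro radial_deriv_scale) auto
      then show ?thesis by (simp add: has_field_derivative_def mult_commute_abs)
    qed
    show "\<bar>b * H' \<sigma> y\<bar> \<le> (2 * C' + n * C) / (\<tau> / 2) ^ (n + 1) * norm b" if "\<sigma> \<in> ball \<tau> (\<tau> / 2)" for \<sigma> y b
    proof -
      have \<sigma>: "0 < \<sigma>" "\<tau> / 2 \<le> \<sigma>" using pos[OF that] \<tau> by auto
      \<comment> \<open>The factor |y - x|^2 / \<sigma>^2 is unbounded, but it exceeds 1 only where
        the bump vanishes.\<close>
      have "\<bar>2 / \<sigma>\<^sup>2 * radial \<sigma> (bump_deriv q) (y - x) * (norm (y - x))\<^sup>2\<bar> \<le> 2 * C'"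
      proof (cases "\<sigma> \<le> norm (y - x)")
        case True
        then show ?thesis using radial_eq_0[OF \<sigma>(1) True] C'(1) by simp
      next
        case False
        then have "(norm (y - x))\<^sup>2 / \<sigma>\<^sup>2 \<le> 1" using \<sigma> by (simp add: power_mono)
        then have "\<bar>radial \<sigma> (bump_deriv q) (y - x)\<bar> * ((norm (y - x))\<^sup>2 / \<sigma>\<^sup>2) \<le> C' * 1"
          using C' by (intro mult_mono) auto
        then show ?thesis by (simp add: abs_mult)
      qed
      moreover have "\<bar>n * radial \<sigma> q (y - x)\<bar> \<le> n * C" using C by (simp add: abs_mult mult_left_mono)
      ultimately have "\<bar>2 / \<sigma>\<^sup>2 * radial \<sigma> (bump_deriv q) (y - x) * (norm (y - x))\<^sup>2 - n * radial \<sigma> q (y - x)\<bar> \<le> 2 * C' + n * C"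
        by linarith
      then have "\<bar>H' \<sigma> y\<bar> \<le> (2 * C' + n * C) / (\<tau> / 2) ^ (n + 1)"
        unfolding H'_def abs_divide using \<sigma> \<tau> C(1) C'(1) by (intro frac_le) (auto simp del: power_Suc intro!: power_mono)
      then have "\<bar>b\<bar> * \<bar>H' \<sigma> y\<bar> \<le> \<bar>b\<bar> * ((2 * C' + n * C) / (\<tau> / 2) ^ (n + 1))"
        by (rule mult_left_mono) simp
      then show ?thesis by (simp only: abs_mult real_norm_def mult.commute)
    qed
  qed (use \<tau> C C' in auto)
  have zero: "(LINT y|lborel. f y * (b * H' \<tau> y)) = 0" if \<tau>: "0 < \<tau>" "\<tau> \<le> t" for \<tau> b
  proof -
    let ?\<phi> = "\<lambda>y. radial \<tau> 1 (y - x)"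
    have sub: "cball x \<tau> \<subseteq> \<Omega>" using \<Omega> \<tau> by (meson dual_order.trans subset_cball)
    have d: "(radial \<tau> 1 :: real^'n \<Rightarrow> real) differentiable_on UNIV" "partial_deriv i (radial \<tau> 1 :: real^'n \<Rightarrow> real) differentiable_on UNIV" for i
      using test_functions_differentiable[OF radial_test_function[OF \<tau>(1)]]
        test_functions_differentiable[OF test_functions_partial_deriv[OF radial_test_function[OF \<tau>(1)]]]
      by (auto simp: differentiable_on_def)
    have "f y * (b * H' \<tau> y) = b * \<tau>\<^sup>2 / (2 * \<tau> ^ (n + 1)) * (f y * (\<Sum>i\<in>UNIV. partial_deriv i (partial_deriv i ?\<phi>) y))" for y
    proof -
      have "(\<Sum>i\<in>UNIV. partial_deriv i (partial_deriv i ?\<phi>) y) = 2 / \<tau>\<^sup>2 * (H' \<tau> y * \<tau> ^ (n + 1))"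
        unfolding partial_deriv_translate[OF d(1)] partial_deriv_translate[OF d(2)] laplacian_radial
        using \<tau>(1) by (simp add: H'_def q_def n_def)
      then show ?thesis using \<tau>(1) by simp
    qed
    then show ?thesis using harmonic[OF \<tau>(1) sub] by simp
  qed
  have "\<exists>c. \<forall>\<tau>\<in>{s..t}. (LINT y|lborel. f y * H \<tau> y) = c"
  proof (rule has_derivative_zero_constant)
    show "((\<lambda>\<tau>. LINT y|lborel. f y * H \<tau> y) has_derivative (\<lambda>h. 0)) (at \<tau> within {s..t})" if "\<tau> \<in> {s..t}" for \<tau>
      using der[of \<tau>] zero[of \<tau>] that s by (auto intro: has_derivative_at_withinI)
  qed simp
  then have "(LINT y|lborel. f y * H s y) = (LINT y|lborel. f y * H t y)" using s by auto
  \<comment> \<open>By \<open>integral_radial\<close> the normalising integral is \<tau>^n times a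
    constant, so \<open>H\<close> is the mollifier up to a factor free of \<tau>.\<close>
  moreover have "conv f (moll \<tau>) x = (LINT y|lborel. f y * H \<tau> y) / (LINT y|lborel. radial 1 q (y :: real^'n))" if "0 < \<tau>" for \<tau>
    unfolding conv_def moll_def integral_radial[OF that] H_def q_def n_def by simp
  ultimately show ?thesis using s by simp
qed

subsection \<open>Estimates for mollified functions\<close>

lemma moll_minus: "moll t (y - x) = moll t (x - y)"
  by (simp add: moll_def radial_def norm_minus_commute)

text \<open>\<open>moll t\<close> is a probability density on the ball of radius t, so the mollified
  value is an average of values of \<psi> at points within t of y.\<close>

lemma conv_moll_close:
  fixes \<psi> :: "real^'n \<Rightarrow> real"
  assumes t: "0 < t" and \<psi>: "integrable lborel \<psi>" and e: "\<And>x. norm (x - y) \<le> t \<Longrightarrow> \<bar>\<psi> x - \<psi> y\<bar> \<le> e"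
  shows "\<bar>conv \<psi> (moll t) y - \<psi> y\<bar> \<le> e"
proof -
  note [measurable] = moll_measurable[OF t]
  obtain C where C: "\<And>x :: real^'n. \<bar>moll t x\<bar> \<le> C" using moll_bounded[OF t] by metis
  have i: "integrable lborel (\<lambda>x. \<psi> x * moll t (x - y))"
    by (rule integrable_times_bounded[OF \<psi>]) (use C in auto)
  note i' = moll_translate_integrable[OF t, of y]
  have "conv \<psi> (moll t) y - \<psi> y = (LINT x|lborel. \<psi> x * moll t (x - y)) - \<psi> y * (LINT x|lborel. moll t (x - y))"
    by (simp add: conv_def integral_moll_translate[OF t])
  also have "\<dots> = (LINT x|lborel. (\<psi> x - \<psi> y) * moll t (x - y))"
    using i i' by (simp add: left_diff_distrib)
  finally have "\<bar>conv \<psi> (moll t) y - \<psi> y\<bar> = \<bar>LINT x|lborel. (\<psi> x - \<psi> y) * moll t (x - y)\<bar>" by simp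
  also have "\<dots> \<le> (LINT x|lborel. \<bar>(\<psi> x - \<psi> y) * moll t (x - y)\<bar>)"
    by (rule integral_abs_bound)
  also have "\<dots> \<le> (LINT x|lborel. e * moll t (x - y))"
  proof (rule integral_mono)
    show "integrable lborel (\<lambda>x. \<bar>(\<psi> x - \<psi> y) * moll t (x - y)\<bar>)"
      using i i' by (simp add: left_diff_distrib)
    show "\<bar>(\<psi> x - \<psi> y) * moll t (x - y)\<bar> \<le> e * moll t (x - y)" for x
    proof (cases "norm (x - y) \<le> t")
      case True
      then show ?thesis using e[OF True] moll_nonneg[OF t, of "x - y"] by (simp add: abs_mult mult_right_mono)
    next
      case False
      then show ?thesis using moll_eq_0[OF t, of "x - y"] by simp
    qed
  qed (use i' in auto)
  also have "\<dots> = e" using integral_moll_translate[OF t, of y] by simp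
  finally show ?thesis .
qed

text \<open>After a change of variables the mollification is an average of translates of
  \<open>m\<close>, each of them 1-Lipschitz. As no constant is lost, the smoothed cutoff has
  gradient at most 1.\<close>

lemma conv_moll_lipschitz:
  fixes m :: "real^'n \<Rightarrow> real"
  assumes t: "0 < t" and m: "integrable lborel m" "\<And>x y. \<bar>m x - m y\<bar> \<le> norm (x - y)"
  shows "\<bar>conv m (moll t) x - conv m (moll t) y\<bar> \<le> norm (x - y)"
proof -
  note [measurable] = moll_measurable[OF t]
  have mm [measurable]: "m \<in> borel_measurable borel" using borel_measurable_integrable[OF m(1)] by simp
  obtain C where C: "\<And>x :: real^'n. \<bar>moll t x\<bar> \<le> C" using moll_bounded[OF t] by metis
  have tr: "conv m (moll t) x = (LINT z|lborel. m (x + z) * moll t z)" for x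
    using lborel_integral_translate[of "\<lambda>y. m y * moll t (y - x)" x] by (simp add: conv_def)
  have mi: "integrable lborel (\<lambda>z. m (x + z))" for x
    using m(1) by (subst (asm) lborel_distr_plus[of x, symmetric]) (auto simp: integrable_distr_eq)
  have i: "integrable lborel (\<lambda>z. m (x + z) * moll t z)" for x
    by (rule integrable_times_bounded[OF mi]) (use C in auto)
  have "\<bar>conv m (moll t) x - conv m (moll t) y\<bar> = \<bar>LINT z|lborel. (m (x + z) - m (y + z)) * moll t z\<bar>"
    unfolding tr using i by (simp add: left_diff_distrib)
  also have "\<dots> \<le> (LINT z|lborel. \<bar>(m (x + z) - m (y + z)) * moll t z\<bar>)"
    by (rule integral_abs_bound)
  also have "\<dots> \<le> (LINT z|lborel. norm (x - y) * moll t (z :: real^'n))"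
  proof (rule integral_mono)
    show "integrable lborel (\<lambda>z. \<bar>(m (x + z) - m (y + z)) * moll t z\<bar>)"
      using i by (simp add: left_diff_distrib)
    show "\<bar>(m (x + z) - m (y + z)) * moll t z\<bar> \<le> norm (x - y) * moll t z" for z
      using m(2)[of "x + z" "y + z"] moll_nonneg[OF t, of z] by (simp add: abs_mult mult_right_mono)
  qed (use moll_integrable[OF t] in auto)
  also have "\<dots> = norm (x - y)" using integral_moll[OF t, where 'n = 'n] by simp
  finally show ?thesis .
qed

text \<open>Differentiating along the direction \<open>D\<close> itself gives
  \<open>D \<bullet> D \<le> norm D\<close>.\<close>

lemma GDERIV_lipschitz:
  assumes D: "GDERIV f x :> D" and lip: "\<And>y. \<bar>f y - f x\<bar> \<le> norm (y - x)"
  shows "norm D \<le> 1"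
proof -
  have h: "((\<lambda>s. x + s *\<^sub>R D) has_derivative (\<lambda>s. s *\<^sub>R D)) (at (0::real))"
    by (auto intro!: derivative_eq_intros)
  have "((\<lambda>s. f (x + s *\<^sub>R D)) has_derivative (\<lambda>s. (s *\<^sub>R D) \<bullet> D)) (at 0)"
    using has_derivative_compose[OF h, of f "\<lambda>h. h \<bullet> D"] D by (simp add: gderiv_def)
  then have "((\<lambda>s. f (x + s *\<^sub>R D)) has_real_derivative D \<bullet> D) (at 0)"
    by (simp add: has_field_derivative_def mult_commute_abs)
  then have "(\<lambda>s. (f (x + s *\<^sub>R D) - f x) / s) \<midarrow>0\<rightarrow> D \<bullet> D"
    by (simp add: DERIV_def)
  moreover have "(f (x + s *\<^sub>R D) - f x) / s \<le> norm D" if "s \<noteq> 0" for s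
  proof -
    have "(f (x + s *\<^sub>R D) - f x) / s \<le> \<bar>f (x + s *\<^sub>R D) - f x\<bar> / \<bar>s\<bar>"
      by (metis abs_divide abs_ge_self)
    also have "\<dots> \<le> norm D" using lip[of "x + s *\<^sub>R D"] that by (simp add: divide_le_eq mult.commute)
    finally show ?thesis .
  qed
  ultimately have "D \<bullet> D \<le> norm D"
    by (intro tendsto_upperbound[of "\<lambda>s. (f (x + s *\<^sub>R D) - f x) / s" _ "at 0"]) (auto simp: eventually_at_filter)
  then have "norm D * norm D \<le> norm D * 1" by (simp add: dot_square_norm power2_eq_square)
  then show ?thesis by (metis mult_le_cancel_left_pos zero_less_norm_iff norm_zero zero_le_one)
qed

text \<open>The mollifier is even, so mollification is self-adjoint.\<close>

lemma conv_moll_fubini: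
  fixes f \<psi> :: "real^'n \<Rightarrow> real"
  assumes t: "0 < t" and f: "integrable lborel f" and \<psi>: "integrable lborel \<psi>"
  shows "(LINT x|lborel. conv f (moll t) x * \<psi> x) = (LINT y|lborel. f y * conv \<psi> (moll t) y)"
proof -
  note [measurable] = moll_measurable[OF t] borel_measurable_integrable[OF f] borel_measurable_integrable[OF \<psi>]
  obtain C where C: "\<And>x :: real^'n. \<bar>moll t x\<bar> \<le> C" using moll_bounded[OF t] by metis
  have "integrable (lborel \<Otimes>\<^sub>M lborel) (\<lambda>(x, y). \<psi> x * f y)"
    by (rule lborel_pair.Fubini_integrable) (use f \<psi> in \<open>auto simp: abs_mult\<close>)
  then have "integrable (lborel \<Otimes>\<^sub>M lborel) (\<lambda>p. (case p of (x, y) \<Rightarrow> \<psi> x * f y) * moll t (snd p - fst p))"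
    by (rule integrable_times_bounded) (use C in auto)
  then have "integrable (lborel \<Otimes>\<^sub>M lborel) (\<lambda>(x, y). \<psi> x * f y * moll t (y - x))"
    by (simp add: case_prod_beta')
  from lborel_pair.Fubini_integral[OF this]
  have "(LINT y|lborel. LINT x|lborel. \<psi> x * f y * moll t (y - x)) = (LINT x|lborel. LINT y|lborel. \<psi> x * f y * moll t (y - x))" .
  moreover have "(LINT x|lborel. \<psi> x * f y * moll t (y - x)) = f y * conv \<psi> (moll t) y" for y
    unfolding conv_def moll_minus[of t y] by (subst integral_mult_right_zero[symmetric]) (simp add: mult_ac)
  moreover have "(LINT y|lborel. \<psi> x * f y * moll t (y - x)) = conv f (moll t) x * \<psi> x" for x
    unfolding conv_def by (subst integral_mult_left_zero[symmetric]) (simp add: mult_ac)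
  ultimately show ?thesis by simp
qed

text \<open>Self-adjointness moves the mollifier onto the continuous function \<psi>, whose
  mollifications converge pointwise and boundedly; the integrable \<open>f\<close> then only
  provides the majorant.\<close>

lemma conv_moll_tendsto:
  fixes f \<psi> :: "real^'n \<Rightarrow> real"
  assumes t: "0 < t" and f: "integrable lborel f" and \<psi>: "\<psi> \<in> test_functions \<Omega>"
  shows "(\<lambda>k. LINT x|lborel. conv f (moll (t / Suc k)) x * \<psi> x) \<longlonglongrightarrow> (LINT x|lborel. f x * \<psi> x)"
proof -
  have c: "continuous_on UNIV \<psi>" by (rule test_functions_continuous[OF \<psi>])
  obtain K where K: "compact K" "\<And>x. x \<notin> K \<Longrightarrow> \<psi> x = 0" using test_functions_support[OF \<psi>] by metis
  have i: "integrable lborel \<psi>" by (rule compactly_supported_integrable[OF c K])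
  obtain B where B: "\<And>x. \<bar>\<psi> x\<bar> \<le> B" using test_functions_bounded[OF \<psi>] by metis
  have tk: "0 < t / Suc k" for k using t by simp
  \<comment> \<open>\<open>2 * B\<close> bounds the oscillation of \<psi> and hence the smoothing
    error; the third \<open>B\<close> accounts for \<psi> itself.\<close>
  have "\<bar>conv \<psi> (moll (t / Suc k)) y\<bar> \<le> 3 * B" for k y
  proof -
    have "\<bar>conv \<psi> (moll (t / Suc k)) y - \<psi> y\<bar> \<le> 2 * B"
    proof (rule conv_moll_close[OF tk i])
      show "\<bar>\<psi> x - \<psi> y\<bar> \<le> 2 * B" for x using B[of x] B[of y] by arith
    qed
    then show ?thesis using B[of y] by arith
  qed
  then have bd: "\<bar>f y * conv \<psi> (moll (t / Suc k)) y\<bar> \<le> 3 * B * \<bar>f y\<bar>" for k y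
    by (simp add: abs_mult mult.commute mult_left_mono)
  have lim: "(\<lambda>k. conv \<psi> (moll (t / Suc k)) y) \<longlonglongrightarrow> \<psi> y" for y
  proof (rule LIMSEQ_I)
    fix e :: real assume "0 < e"
    then obtain d where d: "0 < d" "\<And>x. dist x y < d \<Longrightarrow> dist (\<psi> x) (\<psi> y) < e / 2"
      using c unfolding continuous_on_iff by (metis UNIV_I half_gt_zero)
    obtain N where N: "t / d < real N" using reals_Archimedean2 by blast
    have "norm (conv \<psi> (moll (t / Suc k)) y - \<psi> y) < e" if "k \<ge> N" for k
    proof -
      have "t / d < real (Suc k)" using N that by linarith
      then have "t / Suc k < d" using d(1) by (simp add: divide_less_eq mult.commute)
      then have "\<bar>conv \<psi> (moll (t / Suc k)) y - \<psi> y\<bar> \<le> e / 2"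
        using d(2) by (intro conv_moll_close[OF tk i]) (auto simp: dist_norm intro: less_imp_le)
      with \<open>0 < e\<close> show ?thesis by simp
    qed
    then show "\<exists>N. \<forall>k\<ge>N. norm (conv \<psi> (moll (t / Suc k)) y - \<psi> y) < e" by blast
  qed
  have m: "conv \<psi> (moll (t / Suc k)) \<in> borel_measurable borel" for k
    by (rule borel_measurable_continuous_onI[OF conv_continuous[OF i moll_test_function[OF tk]]])
  have "(\<lambda>k. LINT y|lborel. f y * conv \<psi> (moll (t / Suc k)) y) \<longlonglongrightarrow> (LINT y|lborel. f y * \<psi> y)"
  proof (rule integral_dominated_convergence[where w = "\<lambda>y. 3 * B * \<bar>f y\<bar>"])
    show "(\<lambda>y. f y * conv \<psi> (moll (t / Suc k)) y) \<in> borel_measurable lborel" for k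
      using f m[of k] by auto
    show "(\<lambda>y. f y * \<psi> y) \<in> borel_measurable lborel"
      using f borel_measurable_continuous_onI[OF c] by auto
    show "AE y in lborel. (\<lambda>k. f y * conv \<psi> (moll (t / Suc k)) y) \<longlonglongrightarrow> f y * \<psi> y"
      by (rule AE_I2) (rule tendsto_mult_left[OF lim])
  qed (use f bd in auto)
  then show ?thesis by (simp only: conv_moll_fubini[OF tk f i])
qed

text \<open>Jensen's inequality for the probability density \<open>moll t\<close>, followed by an
  exchange of the two integrations.\<close>

lemma nn_integral_norm_conv_moll:
  fixes w :: "real^'n \<Rightarrow> real^'c"
  assumes t: "0 < t" and w: "\<And>c. integrable lborel (\<lambda>y. w y $ c)" and w2: "integrable lborel (\<lambda>y. (norm (w y))\<^sup>2)"
  defines "W \<equiv> \<lambda>x. \<chi> c. conv (\<lambda>y. w y $ c) (moll t) x"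
  shows "(\<integral>\<^sup>+x. ennreal ((norm (W x))\<^sup>2) \<partial>lborel) \<le> (\<integral>\<^sup>+x. ennreal ((norm (w x))\<^sup>2) \<partial>lborel)"
proof -
  note [measurable] = moll_measurable[OF t]
  have [measurable]: "(\<lambda>y. (norm (w y))\<^sup>2) \<in> borel_measurable borel" using borel_measurable_integrable[OF w2] by simp
  obtain C where C: "\<And>x :: real^'n. \<bar>moll t x\<bar> \<le> C" using moll_bounded[OF t] by metis
  have i1: "integrable lborel (\<lambda>y. w y $ c * moll t (y - x))" for c x
    by (rule integrable_times_bounded[OF w _ C]) measurable
  have i2: "integrable lborel (\<lambda>y. (norm (w y))\<^sup>2 * moll t (y - x))" for x
    by (rule integrable_times_bounded[OF w2 _ C]) measurable
  \<comment> \<open>Jensen by hand: write |W x|^2 as the average of W x \<bullet> w y with W x held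
    fixed, bound this product by half the sum of the squares, and absorb |W x|^2 / 2 on the
    left.\<close>
  have pw: "(norm (W x))\<^sup>2 \<le> (LINT y|lborel. (norm (w y))\<^sup>2 * moll t (y - x))" for x
  proof -
    have "(norm (W x))\<^sup>2 = (\<Sum>c\<in>UNIV. W x $ c * (LINT y|lborel. w y $ c * moll t (y - x)))"
      by (simp add: power2_norm_eq_inner inner_vec_def W_def conv_def)
    also have "\<dots> = (LINT y|lborel. (\<Sum>c\<in>UNIV. W x $ c * (w y $ c * moll t (y - x))))"
      using i1 by (subst Bochner_Integration.integral_sum) auto
    also have "\<dots> \<le> (LINT y|lborel. (norm (W x))\<^sup>2 / 2 * moll t (y - x) + (norm (w y))\<^sup>2 * moll t (y - x) / 2)"
    proof (rule integral_mono)
      show "integrable lborel (\<lambda>y. \<Sum>c\<in>UNIV. W x $ c * (w y $ c * moll t (y - x)))"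
        using i1 by auto
      show "integrable lborel (\<lambda>y. (norm (W x))\<^sup>2 / 2 * moll t (y - x) + (norm (w y))\<^sup>2 * moll t (y - x) / 2)"
        using i2[of x] moll_translate_integrable[OF t, of x] by auto
      fix y
      have "W x \<bullet> w y \<le> (norm (W x))\<^sup>2 / 2 + (norm (w y))\<^sup>2 / 2"
      proof -
        have "0 \<le> (norm (W x - w y))\<^sup>2" by simp
        also have "\<dots> = (norm (W x))\<^sup>2 - 2 * (W x \<bullet> w y) + (norm (w y))\<^sup>2"
          by (simp add: power2_norm_eq_inner inner_diff_left inner_diff_right inner_commute)
        finally show ?thesis by simp
      qed
      then have "(W x \<bullet> w y) * moll t (y - x) \<le> ((norm (W x))\<^sup>2 / 2 + (norm (w y))\<^sup>2 / 2) * moll t (y - x)"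
        using moll_nonneg[OF t] by (rule mult_right_mono)
      then show "(\<Sum>c\<in>UNIV. W x $ c * (w y $ c * moll t (y - x))) \<le> (norm (W x))\<^sup>2 / 2 * moll t (y - x) + (norm (w y))\<^sup>2 * moll t (y - x) / 2"
        by (simp add: inner_vec_def sum_distrib_right mult.assoc distrib_right)
    qed
    also have "\<dots> = (norm (W x))\<^sup>2 / 2 + (LINT y|lborel. (norm (w y))\<^sup>2 * moll t (y - x)) / 2"
      using i2[of x] moll_translate_integrable[OF t, of x] integral_moll_translate[OF t, of x] by simp
    finally show ?thesis by simp
  qed
  have "(\<integral>\<^sup>+x. ennreal ((norm (W x))\<^sup>2) \<partial>lborel) \<le> (\<integral>\<^sup>+x. \<integral>\<^sup>+y. ennreal ((norm (w y))\<^sup>2 * moll t (y - x)) \<partial>lborel \<partial>lborel)"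
  proof (rule nn_integral_mono)
    fix x
    have "(\<integral>\<^sup>+y. ennreal ((norm (w y))\<^sup>2 * moll t (y - x)) \<partial>lborel) = ennreal (LINT y|lborel. (norm (w y))\<^sup>2 * moll t (y - x))"
      by (rule nn_integral_eq_integral[OF i2]) (simp add: moll_nonneg[OF t])
    then show "ennreal ((norm (W x))\<^sup>2) \<le> (\<integral>\<^sup>+y. ennreal ((norm (w y))\<^sup>2 * moll t (y - x)) \<partial>lborel)"
      using pw[of x] by (simp add: ennreal_leI)
  qed
  also have "\<dots> = (\<integral>\<^sup>+y. \<integral>\<^sup>+x. ennreal ((norm (w y))\<^sup>2 * moll t (y - x)) \<partial>lborel \<partial>lborel)"
    by (rule lborel_pair.Fubini'[symmetric]) measurable
  also have "\<dots> = (\<integral>\<^sup>+y. ennreal ((norm (w y))\<^sup>2) \<partial>lborel)"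
  proof (rule nn_integral_cong)
    fix y
    have "(\<integral>\<^sup>+x. ennreal ((norm (w y))\<^sup>2 * moll t (y - x)) \<partial>lborel) = ennreal (LINT x|lborel. (norm (w y))\<^sup>2 * moll t (x - y))"
      unfolding moll_minus[of t y] using moll_translate_integrable[OF t, of y]
      by (intro nn_integral_eq_integral) (auto simp: moll_nonneg[OF t])
    then show "(\<integral>\<^sup>+x. ennreal ((norm (w y))\<^sup>2 * moll t (y - x)) \<partial>lborel) = ennreal ((norm (w y))\<^sup>2)"
      by (simp add: integral_moll_translate[OF t])
  qed
  finally show ?thesis .
qed

text \<open>The field whose j-th component is the sum over i and c of A i j c \<phi>^2 G_i w_c has a
  divergence of integral 0. In its product rule the derivatives of w give \<phi>^2 |G|^2 by
  \<open>Gw\<close>, those of G cancel because antisymmetric coefficients meet a symmetric matrix,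
  and those of \<phi> leave the error term. All functions are smooth enough on the whole space;
  \<open>Gw\<close> alone is confined to \<open>K\<close>.\<close>

lemma caccioppoli:
  fixes G :: "real^'n \<Rightarrow> real^'n" and w :: "real^'n \<Rightarrow> real^'c" and A :: "'n \<Rightarrow> 'n \<Rightarrow> 'c \<Rightarrow> real"
  assumes antisym: "\<And>i j c. A i j c = - A j i c"
    and A: "\<And>a b w. \<bar>\<Sum>i\<in>UNIV. \<Sum>j\<in>UNIV. \<Sum>c\<in>UNIV. A i j c * (a $ i * b $ j * w $ c)\<bar> \<le> norm a * norm b * norm w"
    and G: "\<And>i x. GDERIV (\<lambda>x. G x $ i) x :> DG i x" "\<And>i j. continuous_on UNIV (\<lambda>x. DG i x $ j)"
      "\<And>i j x. DG i x $ j = DG j x $ i"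
    and w: "\<And>c x. GDERIV (\<lambda>x. w x $ c) x :> Dw c x" "\<And>c j. continuous_on UNIV (\<lambda>x. Dw c x $ j)"
      "integrable lborel (\<lambda>x. (norm (w x))\<^sup>2)"
    and \<phi>: "\<And>x. GDERIV \<phi> x :> D\<phi> x" "\<And>j. continuous_on UNIV (\<lambda>x. D\<phi> x $ j)" "\<And>x. norm (D\<phi> x) \<le> 1"
    and K: "compact K" "\<And>x. x \<notin> K \<Longrightarrow> \<phi> x = 0"
    and Gw: "\<And>x i. x \<in> K \<Longrightarrow> G x $ i = (\<Sum>j\<in>UNIV. \<Sum>c\<in>UNIV. A i j c * Dw c x $ j)"
  shows "integrable lborel (\<lambda>x. (\<phi> x)\<^sup>2 * (norm (G x))\<^sup>2)"
    and "(LINT x|lborel. (\<phi> x)\<^sup>2 * (norm (G x))\<^sup>2) \<le> 4 * (LINT x|lborel. (norm (w x))\<^sup>2)"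
proof -
  note cont = GDERIV_continuous_on[OF G(1)] GDERIV_continuous_on[OF w(1)] GDERIV_continuous_on[OF \<phi>(1)] G(2) w(2) \<phi>(2)
  have cG: "continuous_on UNIV G" using cont(1) by (subst continuous_on_componentwise) (auto simp: Basis_vec_def inner_axis)
  show int: "integrable lborel (\<lambda>x. (\<phi> x)\<^sup>2 * (norm (G x))\<^sup>2)"
    by (rule compactly_supported_integrable[OF _ K(1)]) (auto intro!: continuous_intros cont cG simp: K(2))
  define E where "E i c x = (\<phi> x * \<phi> x) *\<^sub>R (G x $ i *\<^sub>R Dw c x + w x $ c *\<^sub>R DG i x)
      + (G x $ i * w x $ c) *\<^sub>R (\<phi> x *\<^sub>R D\<phi> x + \<phi> x *\<^sub>R D\<phi> x)" for i c x
  have E: "GDERIV (\<lambda>x. (\<phi> x * \<phi> x) * (G x $ i * w x $ c)) x :> E i c x" for i c x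
    unfolding E_def by (intro GDERIV_mult \<phi>(1) G(1) w(1))
  have cE: "continuous_on UNIV (\<lambda>x. E i c x $ j)" for i c j
    unfolding E_def by (auto intro!: continuous_intros cont)
  have E0: "(LINT x|lborel. E i c x $ j) = 0" for i c j
    by (rule integral_gradient_compact_support[OF E cE K(1)]) (simp add: K(2))
  have iE: "integrable lborel (\<lambda>x. E i c x $ j)" for i c j
    by (rule compactly_supported_integrable[OF cE K(1)]) (simp add: E_def K(2))
  define S where "S x = (\<Sum>i\<in>UNIV. \<Sum>j\<in>UNIV. \<Sum>c\<in>UNIV. A i j c * E i c x $ j)" for x
  have iS: "integrable lborel S" unfolding S_def using iE by auto
  have S0: "(LINT x|lborel. S x) = 0"
    unfolding S_def using iE E0 by (simp add: Bochner_Integration.integral_sum)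
  \<comment> \<open>\<open>S\<close> is the divergence and has integral 0, so integrating this bound
    yields the claim. Young's inequality 2 a b \<le> a^2/2 + 2 b^2 with a = |\<phi>| |G| and b = |w|
    leaves half of a^2 on the left, whence the constant 4.\<close>
  have lower: "(\<phi> x)\<^sup>2 * (norm (G x))\<^sup>2 / 2 - 2 * (norm (w x))\<^sup>2 \<le> S x" for x
  proof -
    define Q where "Q = (\<Sum>i\<in>UNIV. \<Sum>j\<in>UNIV. \<Sum>c\<in>UNIV. A i j c * (G x $ i * D\<phi> x $ j * w x $ c))"
    define R where "R = (\<Sum>i\<in>UNIV. \<Sum>j\<in>UNIV. \<Sum>c\<in>UNIV. A i j c * (w x $ c * DG i x $ j))"
    \<comment> \<open>Exchanging i and j changes the sign of \<open>A\<close> but not the second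
      derivatives \<open>DG\<close>, so R = -R.\<close>
    have "R = (\<Sum>j\<in>UNIV. \<Sum>i\<in>UNIV. \<Sum>c\<in>UNIV. A i j c * (w x $ c * DG i x $ j))"
      unfolding R_def by (rule sum.swap)
    also have "\<dots> = (\<Sum>j\<in>UNIV. \<Sum>i\<in>UNIV. \<Sum>c\<in>UNIV. - (A j i c * (w x $ c * DG j x $ i)))"
      by (intro sum.cong refl) (subst antisym, subst G(3), simp)
    also have "\<dots> = - R" unfolding R_def by (simp add: sum_negf)
    finally have R: "R = 0" by simp
    have "S x = (\<phi> x)\<^sup>2 * (\<Sum>i\<in>UNIV. \<Sum>j\<in>UNIV. \<Sum>c\<in>UNIV. A i j c * (G x $ i * Dw c x $ j)) + (\<phi> x)\<^sup>2 * R + 2 * \<phi> x * Q"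
      unfolding S_def R_def Q_def E_def sum_distrib_left sum.distrib[symmetric]
      by (intro sum.cong refl) (simp add: algebra_simps power2_eq_square)
    also have "(\<phi> x)\<^sup>2 * (\<Sum>i\<in>UNIV. \<Sum>j\<in>UNIV. \<Sum>c\<in>UNIV. A i j c * (G x $ i * Dw c x $ j)) = (\<phi> x)\<^sup>2 * (norm (G x))\<^sup>2"
    proof (cases "x \<in> K")
      case True
      have "(\<Sum>i\<in>UNIV. \<Sum>j\<in>UNIV. \<Sum>c\<in>UNIV. A i j c * (G x $ i * Dw c x $ j))
         = (\<Sum>i\<in>UNIV. G x $ i * (\<Sum>j\<in>UNIV. \<Sum>c\<in>UNIV. A i j c * Dw c x $ j))"
        unfolding sum_distrib_left by (intro sum.cong refl) (simp add: mult_ac)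
      also have "\<dots> = (norm (G x))\<^sup>2"
        unfolding Gw[OF True, symmetric] by (simp add: power2_norm_eq_inner inner_vec_def)
      finally show ?thesis by simp
    qed (simp add: K(2))
    finally have S: "S x = (\<phi> x)\<^sup>2 * (norm (G x))\<^sup>2 + 2 * \<phi> x * Q" using R by simp
    have "\<bar>Q\<bar> \<le> norm (G x) * norm (D\<phi> x) * norm (w x)" unfolding Q_def by (rule A)
    also have "\<dots> \<le> norm (G x) * 1 * norm (w x)"
      by (intro mult_right_mono mult_left_mono \<phi>(3)) auto
    finally have "\<bar>\<phi> x\<bar> * \<bar>Q\<bar> \<le> \<bar>\<phi> x\<bar> * (norm (G x) * norm (w x))" by (intro mult_left_mono) auto
    then have "\<bar>2 * \<phi> x * Q\<bar> \<le> 2 * (\<bar>\<phi> x\<bar> * norm (G x)) * norm (w x)" by (simp add: abs_mult mult_ac)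
    also have "\<dots> \<le> (\<bar>\<phi> x\<bar> * norm (G x))\<^sup>2 / 2 + 2 * (norm (w x))\<^sup>2"
      using zero_le_power2[of "\<bar>\<phi> x\<bar> * norm (G x) - 2 * norm (w x)"] by (simp add: power2_diff)
    finally show ?thesis using S by (simp add: power_mult_distrib)
  qed
  have "(LINT x|lborel. (\<phi> x)\<^sup>2 * (norm (G x))\<^sup>2 / 2 - 2 * (norm (w x))\<^sup>2) \<le> (LINT x|lborel. S x)"
    by (rule integral_mono[OF _ iS lower]) (use int w(3) in auto)
  then show "(LINT x|lborel. (\<phi> x)\<^sup>2 * (norm (G x))\<^sup>2) \<le> 4 * (LINT x|lborel. (norm (w x))\<^sup>2)"
    using S0 int w(3) by simp
qed

subsection \<open>The weighted gradient estimate\<close>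

text \<open>A segment from x to a point outside \<Omega> meets the frontier, no farther away than
  that point. The gradient estimate is proved with the distance to the complement, and this
  inequality transfers it to the distance to the frontier.\<close>

lemma infdist_frontier_le_infdist_Compl:
  fixes \<Omega> :: "'a::euclidean_space set"
  assumes "x \<in> \<Omega>" "- \<Omega> \<noteq> {}"
  shows "infdist x (frontier \<Omega>) \<le> infdist x (- \<Omega>)"
proof -
  have "infdist x (frontier \<Omega>) \<le> dist x y" if "y \<in> - \<Omega>" for y
  proof -
    have "closed_segment x y \<inter> frontier \<Omega> \<noteq> {}"
      using assms(1) that by (intro connected_Int_frontier) auto
    then obtain z where z: "z \<in> closed_segment x y" "z \<in> frontier \<Omega>" by auto
    have "infdist x (frontier \<Omega>) \<le> dist x z" by (rule infdist_le[OF z(2)])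
    also have "\<dots> \<le> dist x y" using segment_bound(1)[OF z(1)] by (simp add: dist_norm norm_minus_commute)
    finally show ?thesis .
  qed
  then show ?thesis unfolding infdist_notempty[OF assms(2)] by (rule cINF_greatest[OF assms(2)])
qed

text \<open>The common structure of the planar and the spatial conjugacy relation: up to the constant
  tensor \<open>A\<close>, which is antisymmetric in its first two indices, it reads
  \<open>\<partial>\<^sub>i u = \<Sum>\<^sub>j\<^sub>c A\<^sub>i\<^sub>j\<^sub>c \<partial>\<^sub>j v\<^sub>c\<close>.\<close>

locale conjugate_pair =
  fixes \<Omega> :: "(real^'n) set" and A :: "'n \<Rightarrow> 'n \<Rightarrow> 'c::finite \<Rightarrow> real"
    and u :: "real^'n \<Rightarrow> real" and v :: "real^'n \<Rightarrow> real^'c"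
  assumes open_domain: "open \<Omega>" and bounded_domain: "bounded \<Omega>"
    and antisym: "\<And>i j c. A i j c = - A j i c"
    and tensor_bound: "\<And>a b w. \<bar>\<Sum>i\<in>UNIV. \<Sum>j\<in>UNIV. \<Sum>c\<in>UNIV. A i j c * (a $ i * b $ j * w $ c)\<bar> \<le> norm a * norm b * norm w"
    and u: "integrable lborel u" and v: "\<And>c. integrable lborel (\<lambda>x. v x $ c)"
    and v2: "integrable lborel (\<lambda>x. (norm (v x))\<^sup>2)"
    and conjugate: "\<And>\<phi> i. \<phi> \<in> test_functions \<Omega> \<Longrightarrow> (LINT x|lborel. u x * partial_deriv i \<phi> x)
        = (\<Sum>j\<in>UNIV. \<Sum>c\<in>UNIV. A i j c * (LINT x|lborel. v x $ c * partial_deriv j \<phi> x))"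
begin

text \<open>The distance to the complement vanishes off \<Omega> and is 1-Lipschitz on the whole
  space, so its truncations \<open>max 0 (D x - c)\<close> with c > 0 are compactly supported
  cutoffs defined everywhere.\<close>

abbreviation D :: "real^'n \<Rightarrow> real" where "D x \<equiv> infdist x (- \<Omega>)"

lemma Compl_nonempty: "- \<Omega> \<noteq> {}"
  using bounded_domain not_bounded_UNIV by (metis Compl_empty_eq double_compl)

lemma D_pos: "x \<in> \<Omega> \<Longrightarrow> 0 < D x"
  using infdist_pos_not_in_closed[OF _ Compl_nonempty] open_domain by auto

lemma in_domain: "0 < D x \<Longrightarrow> x \<in> \<Omega>"
  by (rule ccontr) simp

lemma cball_subset: "t < D x \<Longrightarrow> cball x t \<subseteq> \<Omega>"
proof
  fix y assume "t < D x" "y \<in> cball x t"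
  then have "\<not> D x \<le> dist x y" by auto
  then show "y \<in> \<Omega>" using infdist_le[of y "- \<Omega>" x] by auto
qed

lemma continuous_D: "continuous_on S D"
  by (intro continuous_intros)

text \<open>Testing the conjugacy with the i-th derivative of \<phi> and summing over i contracts
  \<open>A\<close>, antisymmetric in i and j, with second derivatives of \<phi>, which are
  symmetric.\<close>

lemma harmonic:
  assumes t: "0 < t" and sub: "cball x t \<subseteq> \<Omega>"
  shows "(LINT y|lborel. u y * (\<Sum>i\<in>UNIV. partial_deriv i (partial_deriv i (\<lambda>y. radial t 1 (y - x))) y)) = 0"
proof -
  define \<phi> :: "real^'n \<Rightarrow> real" where "\<phi> = (\<lambda>y. radial t 1 (y - x))"
  have \<phi>: "\<phi> \<in> test_functions \<Omega>" unfolding \<phi>_def by (rule radial_translate_test_function[OF t sub])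
  have \<phi>': "partial_deriv i \<phi> \<in> test_functions \<Omega>" for i by (rule test_functions_partial_deriv[OF \<phi>])
  have r: "(radial t 1 :: real^'n \<Rightarrow> real) \<in> test_functions UNIV" by (rule radial_test_function[OF t])
  have d: "f differentiable_on UNIV" if "f \<in> test_functions UNIV" for f :: "real^'n \<Rightarrow> real"
    using test_functions_differentiable[OF that] by (simp add: differentiable_on_def)
  have sym: "partial_deriv j (partial_deriv i \<phi>) = partial_deriv i (partial_deriv j \<phi>)" for i j
    unfolding \<phi>_def partial_deriv_translate[OF d[OF r]] partial_deriv_translate[OF d[OF test_functions_partial_deriv[OF r]]]
      partial_deriv2_radial by (auto simp: fun_eq_iff mult_ac)
  define I where "I i j c = (LINT x|lborel. v x $ c * partial_deriv j (partial_deriv i \<phi>) x)" for i j c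
  have int: "integrable lborel (\<lambda>y. u y * partial_deriv i (partial_deriv i \<phi>) y)" for i
  proof -
    have p: "partial_deriv i (partial_deriv i \<phi>) \<in> test_functions \<Omega>" by (rule test_functions_partial_deriv[OF \<phi>'])
    obtain B where "\<And>x. \<bar>partial_deriv i (partial_deriv i \<phi>) x\<bar> \<le> B" using test_functions_bounded[OF p] by metis
    moreover have "partial_deriv i (partial_deriv i \<phi>) \<in> borel_measurable lborel"
      using borel_measurable_continuous_onI[OF test_functions_continuous[OF p]] by simp
    ultimately show ?thesis by (intro integrable_times_bounded[OF u])
  qed
  have "(LINT y|lborel. u y * (\<Sum>i\<in>UNIV. partial_deriv i (partial_deriv i \<phi>) y))
    = (\<Sum>i\<in>UNIV. LINT y|lborel. u y * partial_deriv i (partial_deriv i \<phi>) y)"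
    using int by (simp add: sum_distrib_left Bochner_Integration.integral_sum)
  also have "\<dots> = (\<Sum>i\<in>UNIV. \<Sum>j\<in>UNIV. \<Sum>c\<in>UNIV. A i j c * I i j c)"
    unfolding I_def by (intro sum.cong refl conjugate[OF \<phi>'])
  finally have eq: "(LINT y|lborel. u y * (\<Sum>i\<in>UNIV. partial_deriv i (partial_deriv i \<phi>) y))
    = (\<Sum>i\<in>UNIV. \<Sum>j\<in>UNIV. \<Sum>c\<in>UNIV. A i j c * I i j c)" .
  have "(\<Sum>i\<in>UNIV. \<Sum>j\<in>UNIV. \<Sum>c\<in>UNIV. A i j c * I i j c) = (\<Sum>j\<in>UNIV. \<Sum>i\<in>UNIV. \<Sum>c\<in>UNIV. A i j c * I i j c)"
    by (rule sum.swap)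
  also have "\<dots> = (\<Sum>j\<in>UNIV. \<Sum>i\<in>UNIV. \<Sum>c\<in>UNIV. - (A j i c * I j i c))"
    by (intro sum.cong refl) (subst antisym, simp add: I_def sym)
  also have "\<dots> = - (\<Sum>i\<in>UNIV. \<Sum>j\<in>UNIV. \<Sum>c\<in>UNIV. A i j c * I i j c)"
    by (simp add: sum_negf)
  finally show ?thesis using eq unfolding \<phi>_def by simp
qed

section \<open>The gradient of u as a continuous function\<close>

definition G :: "real \<Rightarrow> real^'n \<Rightarrow> real^'n" where
  "G t x = (\<chi> i. - conv u (partial_deriv i (moll t)) x)"

text \<open>\<open>G t\<close> is the gradient of u mollified at radius t and represents the
  gradient of u only at points deeper than t. Half the depth is one admissible radius; by
  \<open>g_eq\<close> every other one gives the same value.\<close>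

definition g :: "real^'n \<Rightarrow> real^'n" where
  "g x = (if x \<in> \<Omega> then G (D x / 2) x else 0)"

lemma GDERIV_G: "0 < t \<Longrightarrow> GDERIV (conv u (moll t)) x :> G t x"
  unfolding G_def by (rule conv_GDERIV[OF u moll_test_function])

lemma GDERIV_G_nth:
  assumes t: "0 < t"
  shows "GDERIV (\<lambda>x. G t x $ i) x :> (\<chi> j. conv u (partial_deriv j (partial_deriv i (moll t))) x)"
  using GDERIV_minus[OF conv_GDERIV[OF u test_functions_partial_deriv[OF moll_test_function[OF t]]], of i x]
  by (simp add: G_def uminus_vec_def)

lemma continuous_G:
  assumes "0 < t"
  shows "continuous_on S (\<lambda>x. G t x)"
  unfolding G_def
  using conv_continuous[OF u test_functions_partial_deriv[OF moll_test_function[OF assms]]]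
  by (intro continuous_intros) (auto intro: continuous_on_subset)

lemma g_eq:
  assumes t: "0 < t" "t < D x"
  shows "g x = G t x"
proof -
  define s where "s = D x / 2"
  have s: "0 < s" "s < D x" using t by (auto simp: s_def)
  \<comment> \<open>Equal gradients require equal functions on a neighbourhood, so both radii are
    compared with the larger one on the open set of points deeper than it.\<close>
  let ?S = "{y. max s t < D y}"
  have op: "open ?S" by (rule open_Collect_less) (auto intro!: continuous_intros)
  have "conv u (moll s) y = conv u (moll t) y" if "y \<in> ?S" for y
  proof -
    have sub: "cball y (max s t) \<subseteq> \<Omega>" using cball_subset that by auto
    have "conv u (moll s) y = conv u (moll (max s t)) y"
      using s by (intro conv_moll_independent[OF u sub] harmonic) auto
    moreover have "conv u (moll t) y = conv u (moll (max s t)) y"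
      using t by (intro conv_moll_independent[OF u sub] harmonic) auto
    ultimately show ?thesis by simp
  qed
  then have "G s x - G t x = 0"
    using s t by (intro GDERIV_local_zero[OF op _ _ GDERIV_diff[OF GDERIV_G GDERIV_G]]) auto
  then show ?thesis using in_domain[of x] t by (auto simp: g_def s_def)
qed

lemma continuous_g: "continuous_on \<Omega> g"
  unfolding continuous_on_eq_continuous_at[OF open_domain]
proof
  fix x assume x: "x \<in> \<Omega>"
  define t where "t = D x / 2"
  have t: "0 < t" "t < D x" using D_pos[OF x] by (auto simp: t_def)
  have op: "open {y. t < D y}" by (rule open_Collect_less) (auto intro!: continuous_intros)
  have "isCont (G t) x"
    using continuous_G[OF t(1), of UNIV] by (simp add: continuous_on_eq_continuous_at)
  then show "isCont g x"
    by (rule continuous_transform_within_openin[of x UNIV _ "{y. t < D y}"])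
      (use op t g_eq[OF t(1)] in auto)
qed

lemma g_measurable [measurable]: "g \<in> borel_measurable borel"
proof -
  have "(\<lambda>x. indicator \<Omega> x *\<^sub>R g x) \<in> borel_measurable borel"
    using open_domain by (intro borel_measurable_continuous_on_indicator continuous_g) auto
  moreover have "(\<lambda>x. indicator \<Omega> x *\<^sub>R g x) = g"
    by (auto simp: g_def indicator_def fun_eq_iff)
  ultimately show ?thesis by simp
qed

text \<open>For the mollified u this is classical integration by parts. On the support of \<phi> all
  small radii give the same gradient \<open>g\<close>, so the right side is constant along the
  sequence and only the left side passes to the limit.\<close>

lemma distr_gradient:
  assumes \<phi>: "\<phi> \<in> test_functions \<Omega>"
  shows "(LINT x|lborel. u x * partial_deriv i \<phi> x) = - (LINT x|lborel. g x $ i * \<phi> x)"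
proof -
  obtain K where K: "compact K" "K \<subseteq> \<Omega>" "\<And>x. x \<notin> K \<Longrightarrow> \<phi> x = 0" using test_functions_support[OF \<phi>] by metis
  obtain t where t: "0 < t" "\<And>x. x \<in> K \<Longrightarrow> t < D x"
  proof (cases "K = {}")
    case True
    with that[of 1] show ?thesis by simp
  next
    case False
    then obtain x where x: "x \<in> K" "\<And>y. y \<in> K \<Longrightarrow> D x \<le> D y"
      using continuous_attains_inf[OF K(1) _ continuous_D] by blast
    then have "0 < D x" using D_pos K(2) by auto
    moreover from this have "D x / 2 < D y" if "y \<in> K" for y using x(2)[OF that] by linarith
    ultimately show ?thesis by (intro that[of "D x / 2"]) auto
  qed
  have \<phi>': "partial_deriv i \<phi> \<in> test_functions \<Omega>" by (rule test_functions_partial_deriv[OF \<phi>])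
  have "(LINT x|lborel. conv u (moll (t / Suc k)) x * partial_deriv i \<phi> x) = - (LINT x|lborel. g x $ i * \<phi> x)" for k
  proof -
    have tk: "0 < t / Suc k" "t / Suc k \<le> t" using t(1) by (auto simp: divide_le_eq)
    have "(LINT x|lborel. conv u (moll (t / Suc k)) x * pgrad \<phi> x $ i) = - (LINT x|lborel. G (t / Suc k) x $ i * \<phi> x)"
    proof (rule integration_by_parts_partial[OF GDERIV_G[OF tk(1)] _ test_functions_GDERIV[OF \<phi>] _ K(1,3)])
      show "continuous_on UNIV (\<lambda>x. G (t / Suc k) x $ i)"
        using continuous_G[OF tk(1)] by (intro continuous_intros)
      show "continuous_on UNIV (\<lambda>x. pgrad \<phi> x $ i)"
        using test_functions_continuous[OF \<phi>'] by simp
    qed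
    moreover have "G (t / Suc k) x $ i * \<phi> x = g x $ i * \<phi> x" for x
    proof (cases "x \<in> K")
      case True
      then have "g x = G (t / Suc k) x" using tk t(2)[OF True] by (intro g_eq) auto
      then show ?thesis by simp
    qed (simp add: K(3))
    ultimately show ?thesis by (simp only: pgrad_nth)
  qed
  with conv_moll_tendsto[OF t(1) u \<phi>']
  have "(\<lambda>k::nat. - (LINT x|lborel. g x $ i * \<phi> x)) \<longlonglongrightarrow> (LINT x|lborel. u x * partial_deriv i \<phi> x)"
    by simp
  then show ?thesis by (rule LIMSEQ_unique[OF _ tendsto_const])
qed

lemma weighted_gradient_bound_cutoff:
  assumes e: "0 < e"
  shows "(\<integral>\<^sup>+x. ennreal ((max 0 (D x - 3 * e))\<^sup>2 * (norm (g x))\<^sup>2) \<partial>lborel) \<le> 4 * (\<integral>\<^sup>+x. ennreal ((norm (v x))\<^sup>2) \<partial>lborel)"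
proof -
  \<comment> \<open>The budget of e: \<open>m\<close> lives where D \<ge> 2 e; smoothing at radius e
    enlarges this set at most to \<open>K\<close> and changes the value by at most e, whence the 3 e
    in the claim. The mollification radius t lies below e, so that balls of radius t about points of
    \<open>K\<close> stay in \<Omega>.\<close>
  define t where "t = e / 2"
  have t: "0 < t" using e by (simp add: t_def)
  define m where "m x = max 0 (D x - 2 * e)" for x
  define \<phi> where "\<phi> = conv m (moll e)"
  define K where "K = {x. e \<le> D x}"
  have cm: "continuous_on UNIV m" unfolding m_def by (intro continuous_intros)
  have m_lip: "\<bar>m x - m y\<bar> \<le> norm (x - y)" for x y
    using infdist_triangle_abs[of x "- \<Omega>" y] unfolding m_def dist_norm by (auto simp: max_def abs_if split: if_splits)
  have Ksub: "K \<subseteq> \<Omega>" using e in_domain by (auto simp: K_def intro: less_le_trans)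
  have "closed K" unfolding K_def by (rule closed_Collect_le) (auto intro!: continuous_intros)
  then have K: "compact K" using bounded_subset[OF bounded_domain Ksub] by (simp add: compact_eq_bounded_closed)
  have m: "integrable lborel m"
    by (rule compactly_supported_integrable[OF cm K]) (use e in \<open>auto simp: m_def K_def\<close>)
  have \<phi>0: "\<phi> x = 0" if "x \<notin> K" for x
  proof -
    have "m y * moll e (y - x) = 0" for y
    proof (cases "e \<le> norm (y - x)")
      case True
      then show ?thesis using moll_eq_0[OF e True] by simp
    next
      case False
      have "D y < 2 * e"
        using that False infdist_triangle_abs[of y "- \<Omega>" x] by (auto simp: K_def dist_norm)
      then show ?thesis by (simp add: m_def)
    qed
    then show ?thesis unfolding \<phi>_def conv_def by (simp only: integral_zero)
  qed
  have \<phi>_lower: "max 0 (D x - 3 * e) \<le> \<bar>\<phi> x\<bar>" for x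
  proof -
    have "\<bar>\<phi> x - m x\<bar> \<le> e" unfolding \<phi>_def
      by (rule conv_moll_close[OF e m]) (use m_lip in \<open>blast intro: order_trans\<close>)
    moreover have "D x - 2 * e \<le> m x" by (simp add: m_def)
    ultimately show ?thesis by (simp add: max_def) linarith
  qed
  define D\<phi> where "D\<phi> x = (\<chi> i. - conv m (partial_deriv i (moll e)) x)" for x
  have \<phi>: "GDERIV \<phi> x :> D\<phi> x" for x
    unfolding \<phi>_def D\<phi>_def by (rule conv_GDERIV[OF m moll_test_function[OF e]])
  have D\<phi>: "norm (D\<phi> x) \<le> 1" for x
    by (rule GDERIV_lipschitz[OF \<phi>]) (simp add: \<phi>_def conv_moll_lipschitz[OF e m m_lip])
  define W where "W x = (\<chi> c. conv (\<lambda>y. v y $ c) (moll t) x)" for x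
  define DW where "DW c x = (\<chi> j. - conv (\<lambda>y. v y $ c) (partial_deriv j (moll t)) x)" for c x
  have W: "GDERIV (\<lambda>x. W x $ c) x :> DW c x" for c x
    unfolding W_def DW_def using conv_GDERIV[OF v moll_test_function[OF t]] by simp
  have M': "partial_deriv i (moll s) \<in> test_functions UNIV" if "0 < s" for s and i :: 'n
    by (rule test_functions_partial_deriv[OF moll_test_function[OF that]])
  have M'': "partial_deriv j (partial_deriv i (moll s)) \<in> test_functions UNIV" if "0 < s" for s and i j :: 'n
    by (rule test_functions_partial_deriv[OF M'[OF that]])
  have cW: "continuous_on UNIV W" unfolding W_def
    by (intro continuous_intros conv_continuous[OF v moll_test_function[OF t]])
  have nnW: "(\<integral>\<^sup>+x. ennreal ((norm (W x))\<^sup>2) \<partial>lborel) \<le> (\<integral>\<^sup>+x. ennreal ((norm (v x))\<^sup>2) \<partial>lborel)"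
    unfolding W_def by (rule nn_integral_norm_conv_moll[OF t v v2])
  also have "\<dots> < \<infinity>" using v2 by (simp add: nn_integral_eq_integral)
  finally have iW: "integrable lborel (\<lambda>x. (norm (W x))\<^sup>2)"
    using borel_measurable_continuous_onI[OF cW] by (intro integrableI_bounded) auto
  \<comment> \<open>The distributional conjugacy, tested with the mollifier centred at x, is the
    pointwise conjugacy of the mollified functions at x.\<close>
  have GW: "G t x $ i = (\<Sum>j\<in>UNIV. \<Sum>c\<in>UNIV. A i j c * DW c x $ j)" if "x \<in> K" for x i
  proof -
    have "t < D x" using that e by (simp add: K_def t_def)
    then have \<psi>: "(\<lambda>y. moll t (y - x)) \<in> test_functions \<Omega>"
      by (intro moll_translate_test_function[OF t] cball_subset)
    have "(moll t :: real^'n \<Rightarrow> real) differentiable_on UNIV"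
      unfolding differentiable_on_def using test_functions_differentiable[OF moll_test_function[OF t]] by blast
    then have "partial_deriv j (\<lambda>y. moll t (y - x)) = (\<lambda>y. partial_deriv j (moll t) (y - x))" for j
      by (rule partial_deriv_translate)
    with conjugate[OF \<psi>, of i] show ?thesis
      by (simp add: G_def DW_def conv_def sum_negf)
  qed
  note cacc = caccioppoli[where G = "G t" and w = W and \<phi> = \<phi> and K = K and D\<phi> = D\<phi> and Dw = DW,
      OF antisym tensor_bound GDERIV_G_nth[OF t] _ _ W _ iW \<phi> _ D\<phi> K \<phi>0 GW]
  have int: "integrable lborel (\<lambda>x. (\<phi> x)\<^sup>2 * (norm (G t x))\<^sup>2)"
   and le: "(LINT x|lborel. (\<phi> x)\<^sup>2 * (norm (G t x))\<^sup>2) \<le> 4 * (LINT x|lborel. (norm (W x))\<^sup>2)"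
    by (rule cacc; auto simp: DW_def D\<phi>_def partial_deriv_moll_commute conv_def[abs_def]
       intro!: continuous_intros conv_continuous[unfolded conv_def[abs_def]] u v m M'[OF t] M''[OF t] M'[OF e])+
  have "(\<integral>\<^sup>+x. ennreal ((max 0 (D x - 3 * e))\<^sup>2 * (norm (g x))\<^sup>2) \<partial>lborel)
    \<le> (\<integral>\<^sup>+x. ennreal ((\<phi> x)\<^sup>2 * (norm (G t x))\<^sup>2) \<partial>lborel)"
  proof (intro nn_integral_mono ennreal_leI)
    fix x
    show "(max 0 (D x - 3 * e))\<^sup>2 * (norm (g x))\<^sup>2 \<le> (\<phi> x)\<^sup>2 * (norm (G t x))\<^sup>2"
    proof (cases "3 * e < D x")
      case True
      then have "g x = G t x" using e by (intro g_eq[OF t]) (simp add: t_def)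
      moreover have "(max 0 (D x - 3 * e))\<^sup>2 \<le> \<bar>\<phi> x\<bar>\<^sup>2" by (intro power_mono \<phi>_lower) simp
      ultimately show ?thesis by (simp add: mult_right_mono)
    qed simp
  qed
  also have "\<dots> = ennreal (LINT x|lborel. (\<phi> x)\<^sup>2 * (norm (G t x))\<^sup>2)"
    by (rule nn_integral_eq_integral[OF int]) simp
  also have "\<dots> \<le> ennreal (4 * (LINT x|lborel. (norm (W x))\<^sup>2))"
    by (rule ennreal_leI[OF le])
  also have "\<dots> = 4 * (\<integral>\<^sup>+x. ennreal ((norm (W x))\<^sup>2) \<partial>lborel)"
    using iW by (simp add: ennreal_mult nn_integral_eq_integral)
  also have "\<dots> \<le> 4 * (\<integral>\<^sup>+x. ennreal ((norm (v x))\<^sup>2) \<partial>lborel)"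
    by (rule mult_left_mono[OF nnW]) simp
  finally show ?thesis .
qed

text \<open>Fatou's lemma along e = 1/(k+1), as the cutoff bound is uniform in e.\<close>

lemma weighted_gradient_bound:
  "(\<integral>\<^sup>+x. ennreal ((D x)\<^sup>2 * (norm (g x))\<^sup>2) \<partial>lborel) \<le> 4 * (\<integral>\<^sup>+x. ennreal ((norm (v x))\<^sup>2) \<partial>lborel)"
proof -
  define f where "f k x = ennreal ((max 0 (D x - 3 * (1 / Suc k)))\<^sup>2 * (norm (g x))\<^sup>2)" for k :: nat and x
  have [measurable]: "D \<in> borel_measurable borel"
    by (rule borel_measurable_continuous_onI[OF continuous_D])
  have [measurable]: "f k \<in> borel_measurable lborel" for k unfolding f_def by measurable
  have lim: "(\<lambda>k. f k x) \<longlonglongrightarrow> ennreal ((D x)\<^sup>2 * (norm (g x))\<^sup>2)" for x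
  proof -
    have "(\<lambda>k. (max 0 (D x - 3 * (1 / Suc k)))\<^sup>2 * (norm (g x))\<^sup>2) \<longlonglongrightarrow> (max 0 (D x - 3 * 0))\<^sup>2 * (norm (g x))\<^sup>2"
      by (intro tendsto_intros LIMSEQ_Suc[OF lim_1_over_n])
    then show ?thesis unfolding f_def by (intro tendsto_ennrealI) (simp add: infdist_nonneg max_absorb2)
  qed
  have "(\<integral>\<^sup>+x. ennreal ((D x)\<^sup>2 * (norm (g x))\<^sup>2) \<partial>lborel) = (\<integral>\<^sup>+x. liminf (\<lambda>k. f k x) \<partial>lborel)"
    by (intro nn_integral_cong) (simp add: lim_imp_Liminf[OF _ lim])
  also have "\<dots> \<le> liminf (\<lambda>k. \<integral>\<^sup>+x. f k x \<partial>lborel)"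
    by (rule nn_integral_liminf) measurable
  also have "\<dots> \<le> 4 * (\<integral>\<^sup>+x. ennreal ((norm (v x))\<^sup>2) \<partial>lborel)"
    unfolding f_def by (intro Liminf_le always_eventually allI weighted_gradient_bound_cutoff) auto
  finally show ?thesis .
qed

end

subsection \<open>The Friedrichs-Velte inequality\<close>

text \<open>The analysis so far uses \<open>lborel\<close> on the whole space, whereas a square
  integrable function on \<Omega> is only Lebesgue measurable there. Extension by zero and a change
  on a null set bridge the gap and keep the norm.\<close>

lemma square_integrable_borel_representative:
  fixes w :: "real^'n \<Rightarrow> real^'c"
  assumes \<Omega>: "open \<Omega>" "bounded \<Omega>" and w: "square_integrable_on w \<Omega>"
  obtains w' where "\<And>c. (\<lambda>x. w' x $ c) \<in> borel_measurable borel"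
    "AE x in lborel. indicator \<Omega> x *\<^sub>R w x = w' x"
    "\<And>c. integrable lborel (\<lambda>x. w' x $ c)" "integrable lborel (\<lambda>x. (norm (w' x))\<^sup>2)"
    "(\<integral>\<^sup>+x. ennreal ((norm (w' x))\<^sup>2) \<partial>lborel) = L2_norm_sq \<Omega> w"
proof -
  have [measurable]: "\<Omega> \<in> sets borel" using \<Omega> by simp
  have "w \<in> borel_measurable (lebesgue_on \<Omega>)" using w by (simp add: square_integrable_on_def)
  then have wm: "(\<lambda>x. indicator \<Omega> x *\<^sub>R w x) \<in> borel_measurable lebesgue"
    using \<Omega> by (subst (asm) borel_measurable_restrict_space_iff) auto
  have nth: "(\<lambda>y :: real^'c. y $ c) \<in> borel_measurable borel" for c
    by (intro borel_measurable_continuous_onI continuous_intros)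
  have "\<exists>h\<in>borel_measurable lborel. AE x in lborel. (indicator \<Omega> x *\<^sub>R w x) $ c = h x" for c
    by (rule completion_ex_borel_measurable_real[OF measurable_compose[OF wm nth]])
  then have "\<exists>h. \<forall>c. h c \<in> borel_measurable lborel \<and> (AE x in lborel. (indicator \<Omega> x *\<^sub>R w x) $ c = h c x)"
    unfolding Bex_def by (intro choice allI)
  then obtain h where h: "\<And>c. h c \<in> borel_measurable lborel" "\<And>c. AE x in lborel. (indicator \<Omega> x *\<^sub>R w x) $ c = h c x"
    by blast
  \<comment> \<open>The indicator makes \<open>w'\<close> vanish everywhere off \<Omega>, not just
    almost everywhere, so the majorant below, integrable since \<Omega> is bounded, holds at each
    point.\<close>
  define w' where "w' x = (\<chi> c. indicator \<Omega> x * h c x)" for x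
  have m: "(\<lambda>x. w' x $ c) \<in> borel_measurable borel" for c
    using h(1)[of c] by (simp add: w'_def)
  have nm [measurable]: "(\<lambda>x. (norm (w' x))\<^sup>2) \<in> borel_measurable borel"
    using m unfolding power2_norm_eq_inner inner_vec_def by simp
  have "AE x in lborel. \<forall>c. (indicator \<Omega> x *\<^sub>R w x) $ c = h c x"
    using h(2) by (subst AE_all_countable) simp
  then have ae: "AE x in lborel. indicator \<Omega> x *\<^sub>R w x = w' x"
    by eventually_elim (auto simp: w'_def vec_eq_iff indicator_def split: if_splits)
  have "L2_norm_sq \<Omega> w = (\<integral>\<^sup>+x. ennreal ((norm (w x))\<^sup>2) * indicator \<Omega> x \<partial>lborel)"
    by (simp add: L2_norm_sq_def nn_integral_completion)
  also have "\<dots> = (\<integral>\<^sup>+x. ennreal ((norm (w' x))\<^sup>2) \<partial>lborel)"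
    by (rule nn_integral_cong_AE) (use ae in eventually_elim, auto simp: indicator_def split: if_splits)
  finally have L2: "(\<integral>\<^sup>+x. ennreal ((norm (w' x))\<^sup>2) \<partial>lborel) = L2_norm_sq \<Omega> w" by simp
  have i2: "integrable lborel (\<lambda>x. (norm (w' x))\<^sup>2)"
    using L2 w by (intro integrableI_bounded) (auto simp: square_integrable_on_def)
  have i1: "integrable lborel (\<lambda>x. w' x $ c)" for c
  proof (rule Bochner_Integration.integrable_bound)
    show "integrable lborel (\<lambda>x. indicator \<Omega> x + (norm (w' x))\<^sup>2 :: real)"
      using i2 emeasure_bounded_finite[OF \<Omega>(2)]
      by (intro Bochner_Integration.integrable_add integrable_real_indicator) auto
    show "(\<lambda>x. w' x $ c) \<in> borel_measurable lborel" using m by simp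
    have "\<bar>w' x $ c\<bar> \<le> indicator \<Omega> x + (norm (w' x))\<^sup>2" for x
    proof (cases "x \<in> \<Omega>")
      case True
      have "\<bar>w' x $ c\<bar> \<le> norm (w' x)" by (rule component_le_norm_cart)
      also have "\<dots> \<le> 1 + (norm (w' x))\<^sup>2"
        using zero_le_power2[of "norm (w' x) - 1"] by (simp add: power2_diff)
          (use zero_le_power2[of "norm (w' x)"] in linarith)
      finally show ?thesis using True by simp
    qed (simp add: w'_def)
    then show "AE x in lborel. norm (w' x $ c) \<le> norm (indicator \<Omega> x + (norm (w' x))\<^sup>2 :: real)"
      by (intro AE_I2) (auto intro: order_trans abs_ge_self)
  qed
  show thesis using that[OF m ae i1 i2 L2] .
qed

text \<open>A distributional derivative sees only the almost-everywhere class, so conjugacy passes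
  from u and v to their Borel representatives.\<close>

lemma distr_partial_representative:
  assumes \<Omega>: "open \<Omega>" and f: "f \<in> borel_measurable (lebesgue_on \<Omega>)" and f': "f' \<in> borel_measurable borel"
    and ae: "AE x in lborel. indicator \<Omega> x * f x = f' x" and \<phi>: "\<phi> \<in> test_functions \<Omega>"
  shows "distr_partial \<Omega> i f \<phi> = - (LINT x|lborel. f' x * partial_deriv i \<phi> x)"
proof -
  have [measurable]: "partial_deriv i \<phi> \<in> borel_measurable borel"
    by (rule borel_measurable_continuous_onI[OF test_functions_continuous[OF test_functions_partial_deriv[OF \<phi>]]])
  have p: "partial_deriv i \<phi> \<in> borel_measurable lebesgue" by (rule measurable_completion) simp
  have fm: "(\<lambda>x. indicator \<Omega> x * f x) \<in> borel_measurable lebesgue"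
    using f \<Omega> by (subst (asm) borel_measurable_restrict_space_iff) auto
  have f'p: "(\<lambda>x. f' x * partial_deriv i \<phi> x) \<in> borel_measurable lborel" using f' by simp
  have "(LINT x:\<Omega>|lebesgue. f x * partial_deriv i \<phi> x) = (LINT x|lebesgue. f' x * partial_deriv i \<phi> x)"
    unfolding set_lebesgue_integral_def
  proof (rule integral_cong_AE)
    show "(\<lambda>x. indicator \<Omega> x *\<^sub>R (f x * partial_deriv i \<phi> x)) \<in> borel_measurable lebesgue"
      using borel_measurable_times[OF fm p] by (simp add: mult.assoc)
    show "(\<lambda>x. f' x * partial_deriv i \<phi> x) \<in> borel_measurable lebesgue"
      using f'p by (rule measurable_completion)
    show "AE x in lebesgue. indicator \<Omega> x *\<^sub>R (f x * partial_deriv i \<phi> x) = f' x * partial_deriv i \<phi> x"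
      using AE_completion[OF ae] by eventually_elim (simp flip: mult.assoc)
  qed
  also have "\<dots> = (LINT x|lborel. f' x * partial_deriv i \<phi> x)" by (rule integral_completion[OF f'p])
  finally show ?thesis by (simp add: distr_partial_def)
qed

lemma friedrichs_velte_estimate:
  fixes \<Omega> :: "(real^'n) set" and A :: "'n \<Rightarrow> 'n \<Rightarrow> 'c::finite \<Rightarrow> real"
    and u :: "real^'n \<Rightarrow> real" and v :: "real^'n \<Rightarrow> real^'c"
  assumes \<Omega>: "open \<Omega>" "bounded \<Omega>"
    and antisym: "\<And>i j c. A i j c = - A j i c"
    and bound: "\<And>a b w. \<bar>\<Sum>i\<in>UNIV. \<Sum>j\<in>UNIV. \<Sum>c\<in>UNIV. A i j c * (a $ i * b $ j * w $ c)\<bar> \<le> norm a * norm b * norm w"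
    and sq_u: "square_integrable_on u \<Omega>" "locally_integrable_on u \<Omega>" "mean_value \<Omega> u = 0"
    and sq_v: "square_integrable_on v \<Omega>"
    and conjugate: "\<And>\<phi> i. \<phi> \<in> test_functions \<Omega> \<Longrightarrow> distr_partial \<Omega> i u \<phi>
        = (\<Sum>j\<in>UNIV. \<Sum>c\<in>UNIV. A i j c * distr_partial \<Omega> j (\<lambda>x. v x $ c) \<phi>)"
    and P: "improved_Poincare_with \<Omega> P" "0 < P"
  shows "L2_norm_sq \<Omega> u \<le> ennreal (4 * P) * L2_norm_sq \<Omega> v"
proof -
  have um: "u \<in> borel_measurable (lebesgue_on \<Omega>)" using sq_u by (simp add: square_integrable_on_def)
  have vm: "v \<in> borel_measurable (lebesgue_on \<Omega>)" using sq_v by (simp add: square_integrable_on_def)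
  \<comment> \<open>The scalar u is viewed as a vector with one component, so that the same
    representative lemma serves u and v.\<close>
  have "(\<lambda>x. vec (u x) :: real^1) \<in> borel_measurable (lebesgue_on \<Omega>)"
  proof (rule measurable_compose[OF um])
    show "(vec :: real \<Rightarrow> real^1) \<in> borel_measurable borel"
      by (intro borel_measurable_continuous_onI) (auto simp: vec_def intro!: continuous_intros)
  qed
  then have u1: "square_integrable_on (\<lambda>x. vec (u x) :: real^1) \<Omega>"
    using sq_u by (simp add: square_integrable_on_def L2_norm_sq_def norm_real)
  obtain U where U: "\<And>c. (\<lambda>x. U x $ c) \<in> borel_measurable borel" "AE x in lborel. indicator \<Omega> x *\<^sub>R (vec (u x) :: real^1) = U x"
    "\<And>c. integrable lborel (\<lambda>x. U x $ c)"
    by (rule square_integrable_borel_representative[OF \<Omega> u1]) (rule that)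
  define u' where "u' x = U x $ 1" for x
  have u': "u' \<in> borel_measurable borel" "integrable lborel u'" unfolding u'_def using U by auto
  have u'ae: "AE x in lborel. indicator \<Omega> x * u x = u' x"
    using U(2) by eventually_elim (simp add: u'_def vec_eq_iff)
  obtain v' where v': "\<And>c. (\<lambda>x. v' x $ c) \<in> borel_measurable borel" "AE x in lborel. indicator \<Omega> x *\<^sub>R v x = v' x"
    "\<And>c. integrable lborel (\<lambda>x. v' x $ c)" "integrable lborel (\<lambda>x. (norm (v' x))\<^sup>2)"
    "(\<integral>\<^sup>+x. ennreal ((norm (v' x))\<^sup>2) \<partial>lborel) = L2_norm_sq \<Omega> v"
    by (rule square_integrable_borel_representative[OF \<Omega> sq_v]) (rule that)
  have v'ae: "AE x in lborel. indicator \<Omega> x * v x $ c = v' x $ c" for c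
    using v'(2) by eventually_elim (auto simp: vec_eq_iff)
  have vcm: "(\<lambda>x. v x $ c) \<in> borel_measurable (lebesgue_on \<Omega>)" for c
    by (rule measurable_compose[OF vm]) (intro borel_measurable_continuous_onI continuous_intros)
  note du = distr_partial_representative[OF \<Omega>(1) um u'(1) u'ae]
  note dv = distr_partial_representative[OF \<Omega>(1) vcm v'(1) v'ae]
  interpret conjugate_pair \<Omega> A u' v'
  proof
    fix \<phi> i assume \<phi>: "\<phi> \<in> test_functions \<Omega>"
    show "(LINT x|lborel. u' x * partial_deriv i \<phi> x)
        = (\<Sum>j\<in>UNIV. \<Sum>c\<in>UNIV. A i j c * (LINT x|lborel. v' x $ c * partial_deriv j \<phi> x))"
      using conjugate[OF \<phi>, of i] unfolding du[OF \<phi>] dv[OF \<phi>] by (simp add: sum_negf)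
  qed (fact \<Omega> antisym bound u' v')+
  have "locally_integrable_on (\<lambda>x. g x $ i) \<Omega>" for i
    unfolding locally_integrable_on_def
  proof (intro allI impI)
    fix K assume K: "compact K \<and> K \<subseteq> \<Omega>"
    then have "continuous_on K (\<lambda>x. g x $ i)"
      using continuous_g by (intro continuous_intros) (auto intro: continuous_on_subset)
    then have i: "integrable lborel (\<lambda>x. indicator K x *\<^sub>R (g x $ i))"
      using K by (intro borel_integrable_compact) auto
    then show "(\<lambda>x. g x $ i) absolutely_integrable_on K"
      unfolding set_integrable_def using integrable_completion[OF borel_measurable_integrable[OF i]] by simp
  qed
  moreover have "distr_grad \<Omega> u \<phi> = (\<chi> i. LINT x:\<Omega>|lebesgue. g x $ i * \<phi> x)" if \<phi>: "\<phi> \<in> test_functions \<Omega>" for \<phi>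
  proof -
    have \<phi>m: "\<phi> \<in> borel_measurable borel"
      by (rule borel_measurable_continuous_onI[OF test_functions_continuous[OF \<phi>]])
    have gm: "(\<lambda>x. g x $ i) \<in> borel_measurable borel" for i
      by (rule measurable_compose[OF g_measurable]) (intro borel_measurable_continuous_onI continuous_intros)
    have "(LINT x:\<Omega>|lebesgue. g x $ i * \<phi> x) = (LINT x|lebesgue. g x $ i * \<phi> x)" for i
      unfolding set_lebesgue_integral_def
      by (rule Bochner_Integration.integral_cong) (auto simp: g_def indicator_def)
    also have "\<dots> i = (LINT x|lborel. g x $ i * \<phi> x)" for i
      by (rule integral_completion) (use gm \<phi>m in simp)
    finally show ?thesis
      unfolding distr_grad_def du[OF \<phi>] distr_gradient[OF \<phi>] by simp
  qed
  \<comment> \<open>\<open>g\<close> was built from the representative \<open>u'\<close>, but it is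
    the distributional gradient of u itself, to which the Poincare inequality is applied.\<close>
  ultimately have grad: "has_distr_grad \<Omega> u g"
    using sq_u(2) by (simp add: has_distr_grad_def)
  define dg where "dg x = infdist x (frontier \<Omega>) *\<^sub>R g x" for x
  have dgm: "dg \<in> borel_measurable lborel"
    unfolding dg_def
    by (simp, intro borel_measurable_scaleR g_measurable borel_measurable_continuous_onI continuous_intros)
  have "L2_norm_sq \<Omega> dg = (\<integral>\<^sup>+x. ennreal ((norm (dg x))\<^sup>2) * indicator \<Omega> x \<partial>lborel)"
    by (simp add: L2_norm_sq_def nn_integral_completion)
  also have "\<dots> \<le> (\<integral>\<^sup>+x. ennreal ((D x)\<^sup>2 * (norm (g x))\<^sup>2) \<partial>lborel)"
  proof (rule nn_integral_mono)
    fix x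
    show "ennreal ((norm (dg x))\<^sup>2) * indicator \<Omega> x \<le> ennreal ((D x)\<^sup>2 * (norm (g x))\<^sup>2)"
    proof (cases "x \<in> \<Omega>")
      case True
      have "(infdist x (frontier \<Omega>))\<^sup>2 \<le> (D x)\<^sup>2"
        using infdist_frontier_le_infdist_Compl[OF True Compl_nonempty] by (intro power_mono infdist_nonneg)
      then show ?thesis
        using True by (auto simp: dg_def power_mult_distrib intro!: ennreal_leI mult_right_mono)
    qed simp
  qed
  also have "\<dots> \<le> 4 * L2_norm_sq \<Omega> v"
    using weighted_gradient_bound unfolding v'(5) .
  finally have le: "L2_norm_sq \<Omega> dg \<le> 4 * L2_norm_sq \<Omega> v" .
  have "dg \<in> borel_measurable (lebesgue_on \<Omega>)"
    by (intro measurable_restrict_space1 measurable_completion dgm)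
  moreover have "4 * L2_norm_sq \<Omega> v < \<infinity>"
    using sq_v by (simp add: square_integrable_on_def ennreal_mult_less_top)
  ultimately have "square_integrable_on dg \<Omega>"
    using le by (simp add: square_integrable_on_def)
  then have "L2_norm_sq \<Omega> (\<lambda>x. u x - mean_value \<Omega> u) \<le> ennreal P * L2_norm_sq \<Omega> dg"
    using P(1) grad unfolding improved_Poincare_with_def dg_def by blast
  also have "\<dots> \<le> ennreal P * (4 * L2_norm_sq \<Omega> v)" by (rule mult_left_mono[OF le]) simp
  also have "\<dots> = ennreal (4 * P) * L2_norm_sq \<Omega> v"
    using P(2) by (simp add: ennreal_mult mult_ac)
  finally show ?thesis using sq_u(3) by simp
qed

section \<open>The planar and the spatial tensor\<close>

lemma Friedrichs_Velte_with_planar: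
  fixes \<Omega> :: "(real^2) set"
  assumes \<Omega>: "open \<Omega>" "bounded \<Omega>" and P: "improved_Poincare_with \<Omega> P" "0 < P"
  shows "Friedrichs_Velte_with conjugate_harmonic2 \<Omega> (4 * P)"
  unfolding Friedrichs_Velte_with_def
proof (intro allI impI)
  fix u v :: "real^2 \<Rightarrow> real"
  assume *: "square_integrable_on u \<Omega> \<and> square_integrable_on v \<Omega> \<and> conjugate_harmonic2 \<Omega> u v \<and> mean_value \<Omega> u = 0"
  \<comment> \<open>The two-dimensional Levi-Civita symbol; the scalar v becomes a field with one
    component, so the third index takes a single value.\<close>
  define A :: "2 \<Rightarrow> 2 \<Rightarrow> 1 \<Rightarrow> real"
    where "A i j c = (if i = 1 \<and> j = 2 then 1 else if i = 2 \<and> j = 1 then - 1 else 0)" for i j c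
  have [simp]: "(1::2) \<noteq> 2" "(2::2) \<noteq> 1" by auto
  have antisym: "A i j c = - A j i c" for i j c by (auto simp: A_def)
  have bound: "\<bar>\<Sum>i\<in>UNIV. \<Sum>j\<in>UNIV. \<Sum>c\<in>UNIV. A i j c * (a $ i * b $ j * w $ c)\<bar> \<le> norm a * norm b * norm w"
    for a b :: "real^2" and w :: "real^1"
  proof -
    \<comment> \<open>Lagrange's identity: the square of the inner product completes the left side
      to |a|^2 |b|^2.\<close>
    have "(a $ 1 * b $ 2 - a $ 2 * b $ 1)\<^sup>2 \<le> (a $ 1 * b $ 2 - a $ 2 * b $ 1)\<^sup>2 + (a $ 1 * b $ 1 + a $ 2 * b $ 2)\<^sup>2"
      by simp
    also have "\<dots> = (norm a * norm b)\<^sup>2"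
      unfolding power_mult_distrib power2_norm_eq_inner inner_vec_def sum_2 by (simp add: power2_eq_square algebra_simps)
    finally have "\<bar>a $ 1 * b $ 2 - a $ 2 * b $ 1\<bar> \<le> norm a * norm b"
      by (rule abs_le_square_iff[THEN iffD2, of _ "norm a * norm b", simplified])
    then have "\<bar>a $ 1 * b $ 2 - a $ 2 * b $ 1\<bar> * \<bar>w $ 1\<bar> \<le> norm a * norm b * \<bar>w $ 1\<bar>"
      by (rule mult_right_mono) simp
    then show ?thesis
      by (simp add: sum_2 sum_1 A_def norm_real left_diff_distrib flip: abs_mult)
  qed
  have "(vec :: real \<Rightarrow> real^1) \<in> borel_measurable borel"
    by (intro borel_measurable_continuous_onI) (auto simp: vec_def intro!: continuous_intros)
  then have v: "square_integrable_on (\<lambda>x. vec (v x) :: real^1) \<Omega>"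
    using * measurable_compose by (auto simp: square_integrable_on_def L2_norm_sq_def norm_real)
  have "distr_partial \<Omega> i u \<phi> = (\<Sum>j\<in>UNIV. \<Sum>c\<in>UNIV. A i j c * distr_partial \<Omega> j (\<lambda>x. (vec (v x) :: real^1) $ c) \<phi>)"
    if "\<phi> \<in> test_functions \<Omega>" for \<phi> i
  proof -
    have "distr_grad \<Omega> u \<phi> $ i = distr_perp_grad \<Omega> v \<phi> $ i"
      using * that by (simp add: conjugate_harmonic2_def)
    then show ?thesis
      using exhaust_2[of i] by (auto simp: distr_grad_def distr_perp_grad_def sum_2 sum_1 A_def)
  qed
  then have "L2_norm_sq \<Omega> u \<le> ennreal (4 * P) * L2_norm_sq \<Omega> (\<lambda>x. vec (v x) :: real^1)"
    using * by (intro friedrichs_velte_estimate[OF \<Omega> antisym bound _ _ _ v _ P]) (auto simp: conjugate_harmonic2_def)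
  then show "L2_norm_sq \<Omega> u \<le> ennreal (4 * P) * L2_norm_sq \<Omega> v"
    by (simp add: L2_norm_sq_def norm_real)
qed

lemma Friedrichs_Velte_with_spatial:
  fixes \<Omega> :: "(real^3) set"
  assumes \<Omega>: "open \<Omega>" "bounded \<Omega>" and P: "improved_Poincare_with \<Omega> P" "0 < P"
  shows "Friedrichs_Velte_with conjugate_harmonic3 \<Omega> (4 * P)"
  unfolding Friedrichs_Velte_with_def
proof (intro allI impI)
  fix u :: "real^3 \<Rightarrow> real" and v :: "real^3 \<Rightarrow> real^3"
  assume *: "square_integrable_on u \<Omega> \<and> square_integrable_on v \<Omega> \<and> conjugate_harmonic3 \<Omega> u v \<and> mean_value \<Omega> u = 0"
  \<comment> \<open>The three-dimensional Levi-Civita symbol: contracting it with a, b and w gives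
    the triple product, so the required bound reduces to |a \<times> b| \<le> |a| |b|.\<close>
  define A :: "3 \<Rightarrow> 3 \<Rightarrow> 3 \<Rightarrow> real" where "A i j c = cross3 (axis i 1) (axis j 1) $ c" for i j c
  have antisym: "A i j c = - A j i c" for i j c
    unfolding A_def by (subst cross_skew) simp
  have ax: "axis i (1::real) $ j = (if j = i then 1 else 0)" for i j :: 3 by (simp add: axis_def)
  have ne: "(1::3) \<noteq> 2" "(2::3) \<noteq> 1" "(1::3) \<noteq> 3" "(3::3) \<noteq> 1" "(2::3) \<noteq> 3" "(3::3) \<noteq> 2" by auto
  have bound: "\<bar>\<Sum>i\<in>UNIV. \<Sum>j\<in>UNIV. \<Sum>c\<in>UNIV. A i j c * (a $ i * b $ j * w $ c)\<bar> \<le> norm a * norm b * norm w"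
    for a b w :: "real^3"
  proof -
    have "(\<Sum>i\<in>UNIV. \<Sum>j\<in>UNIV. \<Sum>c\<in>UNIV. A i j c * (a $ i * b $ j * w $ c)) = cross3 a b \<bullet> w"
      by (simp add: A_def sum_3 cross_components ax ne inner_vec_def algebra_simps)
    also have "\<bar>\<dots>\<bar> \<le> norm (cross3 a b) * norm w" by (rule Cauchy_Schwarz_ineq2)
    also have "\<dots> \<le> norm a * norm b * norm w"
    proof (rule mult_right_mono)
      have "(norm (cross3 a b))\<^sup>2 \<le> (norm a * norm b)\<^sup>2"
        using norm_cross_dot[of a b] zero_le_power2[of "a \<bullet> b"] by linarith
      then show "norm (cross3 a b) \<le> norm a * norm b"
        by (rule power2_le_imp_le) simp
    qed simp
    finally show ?thesis .
  qed
  have "distr_partial \<Omega> i u \<phi> = (\<Sum>j\<in>UNIV. \<Sum>c\<in>UNIV. A i j c * distr_partial \<Omega> j (\<lambda>x. v x $ c) \<phi>)"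
    if "\<phi> \<in> test_functions \<Omega>" for \<phi> i
  proof -
    have "distr_rot \<Omega> v \<phi> $ i = distr_grad \<Omega> u \<phi> $ i"
      using * that by (simp add: conjugate_harmonic3_def)
    then show ?thesis
      using exhaust_3[of i] by (auto simp: distr_grad_def distr_rot_def sum_3 A_def cross_components ax ne)
  qed
  then show "L2_norm_sq \<Omega> u \<le> ennreal (4 * P) * L2_norm_sq \<Omega> v"
    using * by (intro friedrichs_velte_estimate[OF \<Omega> antisym bound _ _ _ _ _ P]) (auto simp: conjugate_harmonic3_def)
qed

text \<open>Each admissible Poincare constant P yields the admissible Friedrichs-Velte constant 4 P,
  so the comparison passes to the infima.\<close>

lemma Friedrichs_Velte_const_le:
  assumes "supports_improved_Poincare \<Omega>"
    and FV: "\<And>P. improved_Poincare_with \<Omega> P \<Longrightarrow> 0 < P \<Longrightarrow> Friedrichs_Velte_with CH \<Omega> (4 * P)"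
  shows "supports_Friedrichs_Velte CH \<Omega> \<and> Friedrichs_Velte_const CH \<Omega> \<le> 4 * improved_Poincare_const \<Omega>"
proof
  obtain P where P: "0 < P" "improved_Poincare_with \<Omega> P"
    using assms(1) by (auto simp: supports_improved_Poincare_def)
  then have "0 < 4 * P" "Friedrichs_Velte_with CH \<Omega> (4 * P)" using FV by auto
  then show "supports_Friedrichs_Velte CH \<Omega>" unfolding supports_Friedrichs_Velte_def by blast
  \<comment> \<open>Division by 4 turns the claim into a lower bound for all admissible Poincare
    constants, which \<open>cInf_greatest\<close> carries over to their infimum.\<close>
  have "Friedrichs_Velte_const CH \<Omega> / 4 \<le> improved_Poincare_const \<Omega>"
    unfolding improved_Poincare_const_def
  proof (rule cInf_greatest)
    show "{P. 0 < P \<and> improved_Poincare_with \<Omega> P} \<noteq> {}" using P by blast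
    fix Q assume "Q \<in> {P. 0 < P \<and> improved_Poincare_with \<Omega> P}"
    then have "4 * Q \<in> {\<Gamma>. 0 < \<Gamma> \<and> Friedrichs_Velte_with CH \<Omega> \<Gamma>}" using FV by auto
    moreover have "bdd_below {\<Gamma>. 0 < \<Gamma> \<and> Friedrichs_Velte_with CH \<Omega> \<Gamma>}" by (rule bdd_belowI[of _ 0]) auto
    ultimately have "Friedrichs_Velte_const CH \<Omega> \<le> 4 * Q"
      unfolding Friedrichs_Velte_const_def by (rule cInf_lower)
    then show "Friedrichs_Velte_const CH \<Omega> / 4 \<le> Q" by simp
  qed
  then show "Friedrichs_Velte_const CH \<Omega> \<le> 4 * improved_Poincare_const \<Omega>" by simp
qed

theorem lemma3p1:
  "(\<forall>\<Omega> :: (real^2) set.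
      open \<Omega> \<and> connected \<Omega> \<and> \<Omega> \<noteq> {} \<and> bounded \<Omega> \<and> supports_improved_Poincare \<Omega> \<longrightarrow>
      supports_Friedrichs_Velte conjugate_harmonic2 \<Omega> \<and>
      Friedrichs_Velte_const conjugate_harmonic2 \<Omega> \<le> 4 * improved_Poincare_const \<Omega>) \<and>
   (\<forall>\<Omega> :: (real^3) set.
      open \<Omega> \<and> connected \<Omega> \<and> \<Omega> \<noteq> {} \<and> bounded \<Omega> \<and> supports_improved_Poincare \<Omega> \<longrightarrow>
      supports_Friedrichs_Velte conjugate_harmonic3 \<Omega> \<and>
      Friedrichs_Velte_const conjugate_harmonic3 \<Omega> \<le> 4 * improved_Poincare_const \<Omega>)"
  by (intro conjI allI impI Friedrichs_Velte_const_le[THEN conjunct1] Friedrichs_Velte_const_le[THEN conjunct2])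
    (auto intro: Friedrichs_Velte_with_planar Friedrichs_Velte_with_spatial)

end
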